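(* Let $\alpha$ be a lattice point in $S$ which lies in the interior $P^o$ of the polytope $P$. Then, for every $f\in L(S)^*$, as $N\to\infty$, $$\mathcal P_N^c(N\alpha+f)=(2\pi N)^{-m/2}\,\frac{|\Pi(S)|\,e^{-\langle f,\tau_P(\alpha)\rangle+N\delta_c(S,\alpha)}}{\sqrt{\det A_c(S,\alpha)}}\,\bigl(1+O(N^{-1})\bigr),$$ where $|\Pi(S)|$ is the order of the finite group $\Pi(S)=L(S)/L$. The exponent $\delta_c(S,\alpha)$ is positive if $c(\alpha)\ge1$.
   Context: $X$ is a real vector space of finite dimension $m$, $L\subset X$ a (full rank) lattice, $X^*$ the dual space and $L^*=\{\beta\in X^*:\langle\beta,x\rangle\in\mathbb Z\ \forall x\in L\}$ the dual lattice. $S\subset L^*$ is a finite set with $\#S\ge2$ such that $D(S)=\{\beta-\beta':\beta,\beta'\in S\}$ spans $X^*$ over $\mathbb R$; $P$ is the convex hull of $S$. $L(S)^*=\mathrm{span}_{\mathbb Z}D(S)\subset L^*$ and $L(S)\supset L$ is its dual lattice in $X$. $c:S\to\mathbb R_{>0}$ is a strictly positive function. The weighted number of lattice paths is $$\mathcal P_N^c(\gamma)=\sum_{\beta_1,\dots,\beta_N\in S,\ \beta_1+\cdots+\beta_N=\gamma}c(\beta_1)\cdots c(\beta_N).$$ The map $\mu_P:X\to P^o$, $\mu_P(\tau)=\sum_{\beta\in S}\frac{c(\beta)e^{\langle\beta,\tau\rangle}}{\sum_{\beta'\in S}c(\beta')e^{\langle\beta',\tau\rangle}}\beta$, is a diffeomorphism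 with inverse $\tau_P:P^o\to X$. For $x\in P^o$, $$\delta_c(S,x)=\log\Bigl(\sum_{\beta\in S}c(\beta)e^{\langle\beta-x,\tau_P(x)\rangle}\Bigr),$$ $$A_c(S,x)=\sum_{\beta\in S}\frac{c(\beta)e^{\langle\beta,\tau_P(x)\rangle}}{\sum_{\beta'\in S}c(\beta')e^{\langle\beta',\tau_P(x)\rangle}}\,\beta\otimes\beta-x\otimes x:\ X\to X^*$$ (a positive definite map, with $(\beta\otimes\beta)y=\langle\beta,y\rangle\beta$). Determinants of maps $X\to X^*$ are taken with respect to a $\mathbb Z$-basis of $L$ and its dual basis. *)

theory Defs
  imports "HOL-Analysis.Analysis" "HOL-Algebra.Coset" "HOL-Library.Landau_Symbols"
begin

text \<open>The space \<open>X\<close> is a type \<open>'a\<close> of class \<^class>\<open>euclidean_space\<close>, of dimension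
  \<open>m = DIM('a)\<close>; its inner product is never used. The dual space is the type of (bounded) linear
  functionals.\<close>

type_synonym 'a dual = "'a \<Rightarrow>\<^sub>L real"

abbreviation pairing :: "'a::real_normed_vector dual \<Rightarrow> 'a \<Rightarrow> real"
  where "pairing \<equiv> blinfun_apply"

abbreviation int_span :: "'v::real_vector set \<Rightarrow> 'v set"
  where "int_span \<equiv> module.span (\<lambda>k::int. scaleR (real_of_int k))"

definition full_lattice :: "'a::euclidean_space set \<Rightarrow> bool"
  where "full_lattice L \<longleftrightarrow> (\<exists>B. independent B \<and> span B = UNIV \<and> L = int_span B)"

text \<open>A \<open>\<int>\<close>-basis of a lattice: by discreteness, independence over \<open>\<int>\<close> and over
  \<open>\<real>\<close> agree for generating families.\<close>

definition lattice_basis :: "('n::finite \<Rightarrow> 'a::euclidean_space) \<Rightarrow> 'a set \<Rightarrow> bool"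
  where "lattice_basis e L \<longleftrightarrow> inj e \<and> independent (range e) \<and> L = int_span (range e)"

definition dual_lattice :: "'a::euclidean_space set \<Rightarrow> 'a dual set"
  where "dual_lattice L = {\<beta>. \<forall>x\<in>L. pairing \<beta> x \<in> \<int>}"

definition diffs :: "'v::ab_group_add set \<Rightarrow> 'v set"
  where "diffs S = {\<beta> - \<beta>' | \<beta> \<beta>'. \<beta> \<in> S \<and> \<beta>' \<in> S}"

text \<open>\<open>lattice_of_dual S\<close> is \<open>L(S)\<^sup>*\<close>, which comes first; the lattice
  \<open>L(S) = lattice_of S\<close> in \<open>X\<close> is its dual and contains \<open>L\<close> when \<open>S \<subseteq> L\<^sup>*\<close>.\<close>

definition lattice_of_dual :: "'a::euclidean_space dual set \<Rightarrow> 'a dual set"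
  where "lattice_of_dual S = int_span (diffs S)"

definition lattice_of :: "'a::euclidean_space dual set \<Rightarrow> 'a set"
  where "lattice_of S = {x. \<forall>\<beta>\<in>lattice_of_dual S. pairing \<beta> x \<in> \<int>}"

definition Pi_group :: "'a::euclidean_space set \<Rightarrow> 'a dual set \<Rightarrow> 'a set monoid"
  where "Pi_group L S = \<lparr>carrier = lattice_of S, monoid.mult = (+), one = 0\<rparr> Mod L"

definition weighted_paths ::
    "'a::euclidean_space dual set \<Rightarrow> ('a dual \<Rightarrow> real) \<Rightarrow> nat \<Rightarrow> 'a dual \<Rightarrow> real"
  where "weighted_paths S c N \<gamma> =
    (\<Sum>bs \<in> {bs. length bs = N \<and> set bs \<subseteq> S \<and> sum_list bs = \<gamma>}. prod_list (map c bs))"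

definition weight ::
    "'a::euclidean_space dual set \<Rightarrow> ('a dual \<Rightarrow> real) \<Rightarrow> 'a \<Rightarrow> 'a dual \<Rightarrow> real"
  where "weight S c \<tau> \<beta> =
    c \<beta> * exp (pairing \<beta> \<tau>) / (\<Sum>\<beta>'\<in>S. c \<beta>' * exp (pairing \<beta>' \<tau>))"

definition mu_P ::
    "'a::euclidean_space dual set \<Rightarrow> ('a dual \<Rightarrow> real) \<Rightarrow> 'a \<Rightarrow> 'a dual"
  where "mu_P S c \<tau> = (\<Sum>\<beta>\<in>S. weight S c \<tau> \<beta> *\<^sub>R \<beta>)"

text \<open>\<^term>\<open>mu_P S c\<close> is injective with range \<^term>\<open>interior (convex hull S)\<close> (when \<open>c\<close> is
  positive on \<open>S\<close> and \<^term>\<open>diffs S\<close> spans), so \<open>tau_P S c\<close> is meaningful on that set only.\<close>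

definition tau_P ::
    "'a::euclidean_space dual set \<Rightarrow> ('a dual \<Rightarrow> real) \<Rightarrow> 'a dual \<Rightarrow> 'a"
  where "tau_P S c = inv_into UNIV (mu_P S c)"

definition delta ::
    "'a::euclidean_space dual set \<Rightarrow> ('a dual \<Rightarrow> real) \<Rightarrow> 'a dual \<Rightarrow> real"
  where "delta S c x = ln (\<Sum>\<beta>\<in>S. c \<beta> * exp (pairing (\<beta> - x) (tau_P S c x)))"

definition tensor :: "'a::euclidean_space dual \<Rightarrow> 'a dual \<Rightarrow> 'a \<Rightarrow> 'a dual"
  where "tensor \<beta> \<beta>' y = pairing \<beta> y *\<^sub>R \<beta>'"

definition A_map ::
    "'a::euclidean_space dual set \<Rightarrow> ('a dual \<Rightarrow> real) \<Rightarrow> 'a dual \<Rightarrow> 'a \<Rightarrow> 'a dual"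
  where "A_map S c x y =
    (\<Sum>\<beta>\<in>S. weight S c (tau_P S c x) \<beta> *\<^sub>R tensor \<beta> \<beta> y) - tensor x x y"

text \<open>The \<open>(i, j)\<close> entry is the coefficient of the dual basis vector \<open>e\<^sub>i\<^sup>*\<close> in
  \<open>A (e\<^sub>j)\<close>, so this is the determinant of \<open>A\<close> with respect to \<open>e\<close> and its dual basis.\<close>

definition det_dual :: "('n::finite \<Rightarrow> 'a::euclidean_space) \<Rightarrow> ('a \<Rightarrow> 'a dual) \<Rightarrow> real"
  where "det_dual e A = det (\<chi> i j. pairing (A (e j)) (e i))"

end

theory Submission
  imports Defs "HOL-Probability.Distributions" "HOL-Real_Asymp.Real_Asymp"
begin

text \<open>The idea is exponential tilting followed by a local limit theorem. Put \<open>\<tau> = \<tau>\<^sub>P(\<alpha>)\<close> and let \<open>w\<close> be the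
weights at \<open>\<tau>\<close>. Multiplying \<open>c(\<beta>)\<close> by \<open>exp \<langle>\<beta>,\<tau>\<rangle>\<close> multiplies the weight of a path by a factor that
depends on its end point and its length only, so up to the explicit factor
\<open>exp (N \<delta> - \<langle>f,\<tau>\<rangle>)\<close> the weighted number of paths is the probability that a random walk with steps
\<open>\<beta> - \<alpha>\<close>, taken with probabilities \<open>w(\<beta>)\<close>, is at \<open>f\<close> after \<open>N\<close> steps. The walk is centred because
\<open>\<mu>\<^sub>P(\<tau>) = \<alpha>\<close>, and its covariance form is \<open>A\<^sub>c(S,\<alpha>)\<close>. The point \<open>\<tau>\<close> exists since the convex function
\<open>\<tau> \<mapsto> \<Sum> c(\<beta>) exp \<langle>\<beta> - \<alpha>,\<tau>\<rangle>\<close> grows in every direction when \<open>\<alpha>\<close> is interior, so that it has a critical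
point (\<open>mu_P_surj_interior\<close>).

In coordinates with respect to the basis \<open>e\<close> of \<open>L\<close> the steps become integer vectors \<open>v\<^sub>b\<close>, and Fourier
inversion writes the probability as the integral over the torus of
\<open>exp (- 2 \<pi> \<i> g \<bullet> t) \<phi>(t) ^ N\<close>, where \<open>\<phi>(t)\<close> is the sum of the \<open>w\<^sub>b exp (2 \<pi> \<i> v\<^sub>b \<bullet> t)\<close>. The modulus
of \<open>\<phi>\<close> is 1 exactly on the group of periods, the vectors \<open>t\<close> with all \<open>v\<^sub>b \<bullet> t\<close> integral, which is \<open>L(S)\<close>
in coordinates. Adding a period changes neither \<open>\<phi>\<close> nor, for \<open>g\<close> coming from \<open>L(S)\<^sup>*\<close>, the other factor.
Hence each of the \<open>|L(S)/L|\<close> classes of periods contributes the same amount, and everything else is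
exponentially small. For some \<open>q\<close> all periods lie in \<open>\<int>\<^sup>n / q\<close> (\<open>periods_denominator\<close>), so the torus is
cut into cubes of side \<open>1/q\<close> around the points of \<open>\<int>\<^sup>n / q\<close>, and each cube either is centred at
a period or avoids the periods altogether.

Near 0 one has \<open>\<phi>(t) = exp (- 2 \<pi>\<^sup>2 t \<bullet> A t) + u\<close>, where the imaginary part of \<open>u\<close> is of order \<open>|t|\<^sup>3\<close>
and the real part of order \<open>|t|\<^sup>4\<close>. The probability is real, so only real parts matter, and in the
first-order expansion of \<open>\<phi>\<^sup>N\<close> about the Gaussian the cubic term drops out. This is why the relative
error is of order \<open>1/N\<close> rather than \<open>1/\<surd>N\<close>; the quantitative form is \<open>power_vs_gaussian\<close>. What remains is the Gaussian
integral \<open>(2 \<pi> N) powr (- n/2) / \<surd>(det A)\<close>, and the two are joined in \<open>local_limit\<close>.\<close>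

section \<open>Gaussian integrals\<close>

lemma gaussian_integral_real:
  fixes c :: real assumes "c > 0"
  shows "(\<integral>\<^sup>+x. ennreal (exp (- c * x\<^sup>2)) \<partial>lborel) = ennreal (sqrt (pi / c))"
proof -
  define s where "s = sqrt (1 / (2 * c))"
  have s: "s > 0" "s\<^sup>2 = 1 / (2 * c)" using assms by (auto simp: s_def)
  have eq: "exp (- c * x\<^sup>2) = sqrt (pi / c) * normal_density 0 s x" for x
  proof -
    have "2 * pi * s\<^sup>2 = pi / c" using s assms by (simp add: field_simps)
    moreover have "- (x - 0)\<^sup>2 / (2 * s\<^sup>2) = - c * x\<^sup>2" using s assms by (simp add: field_simps)
    ultimately show ?thesis using assms by (simp add: normal_density_def)
  qed
  have "(\<integral>\<^sup>+x. ennreal (normal_density 0 s x) \<partial>lborel) = 1"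
  proof -
    interpret prob_space "density lborel (normal_density 0 s)"
      by (rule prob_space_normal_density[OF s(1)])
    show ?thesis using emeasure_space_1 by (simp add: emeasure_density)
  qed
  then show ?thesis
    using assms s unfolding eq
    by (simp add: ennreal_mult' nn_integral_cmult)
qed

lemma Basis_cart: "(Basis :: (real^'n) set) = range (\<lambda>i. axis i 1)"
  by (auto simp: Basis_vec_def)

lemma prod_Basis_cart:
  "(\<Prod>b\<in>(Basis :: (real^'n) set). h b) = (\<Prod>i\<in>UNIV. h (axis i 1))"
  unfolding Basis_cart by (subst prod.reindex) (auto simp: inj_on_def axis_eq_axis)

lemma gaussian_integral_norm:
  fixes c :: real assumes "c > 0"
  shows "(\<integral>\<^sup>+x. ennreal (exp (- c * (norm (x :: real^'n))\<^sup>2)) \<partial>lborel)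
           = ennreal ((pi / c) powr (real CARD('n) / 2))"
proof -
  have "exp (- c * (norm x)\<^sup>2) = (\<Prod>b\<in>Basis. exp (- c * (x \<bullet> b)\<^sup>2))" for x :: "real^'n"
  proof -
    have "(norm x)\<^sup>2 = (\<Sum>b\<in>Basis. (x \<bullet> b)\<^sup>2)"
      by (metis (no_types, lifting) euclidean_inner power2_norm_eq_inner power2_eq_square sum.cong)
    then have "- c * (norm x)\<^sup>2 = (\<Sum>b\<in>Basis. - c * (x \<bullet> b)\<^sup>2)" by (simp only: sum_distrib_left)
    then show ?thesis by (simp only: exp_sum finite_Basis)
  qed
  then have "(\<integral>\<^sup>+x. ennreal (exp (- c * (norm (x :: real^'n))\<^sup>2)) \<partial>lborel)
     = (\<integral>\<^sup>+x. (\<Prod>b\<in>(Basis :: (real^'n) set). ennreal (exp (- c * (x \<bullet> b)\<^sup>2))) \<partial>lborel)"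
    by (simp add: prod_ennreal)
  also have "\<dots> = (\<Prod>b\<in>(Basis :: (real^'n) set). ennreal (sqrt (pi / c)))"
    using gaussian_integral_real[OF assms] by (subst nn_integral_lborel_prod) auto
  also have "\<dots> = ennreal (sqrt (pi / c) ^ CARD('n))"
    using assms by (simp add: ennreal_power)
  also have "sqrt (pi / c) ^ CARD('n) = (pi / c) powr (real CARD('n) / 2)"
    using assms by (simp add: powr_half_sqrt[symmetric] powr_realpow[symmetric] powr_powr)
  finally show ?thesis .
qed

text \<open>Lebesgue measure is determined by its values on boxes, so it suffices to know the volume of the
preimage of a box under \<open>g\<close>.\<close>

lemma nn_integral_linear_cart:
  fixes g :: "real^'n::{finite,wellorder} \<Rightarrow> real^'n::_" and f :: "real^'n::_ \<Rightarrow> ennreal"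
  assumes g: "linear g" "bij g" and f: "f \<in> borel_measurable borel"
  shows "(\<integral>\<^sup>+x. f x \<partial>lborel) = ennreal \<bar>det (matrix g)\<bar> * (\<integral>\<^sup>+x. f (g x) \<partial>lborel)"
proof -
  define d where "d = \<bar>det (matrix g)\<bar>"
  have [measurable]: "g \<in> borel_measurable borel"
    using g(1) by (intro borel_measurable_continuous_onI linear_continuous_on linear_linear[THEN iffD1]) (simp add: linear_linear)
  let ?h = "inv_into UNIV g"
  have lh: "linear ?h" using g by (simp add: bij_is_inj inj_linear_imp_inv_linear)
  have "lborel = density (distr lborel borel g) (\<lambda>_. ennreal d)"
  proof (rule lborel_eqI)
    fix l u :: "real^'n::_" assume le: "\<And>b. b \<in> Basis \<Longrightarrow> l \<bullet> b \<le> u \<bullet> b"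
    have vi: "g -` box l u = ?h ` box l u"
      using g(2) by (simp add: bij_vimage_eq_inv_image)
    have S: "box l u \<in> lmeasurable" by simp
    have "g ` (?h ` box l u) = box l u" using g(2) by (metis image_f_inv_f bij_is_surj)
    moreover have m: "?h ` box l u \<in> lmeasurable"
      by (rule measurable_linear_image[OF lh S])
    ultimately have me: "measure lebesgue (box l u) = d * measure lebesgue (?h ` box l u)"
      using measure_linear_image[OF g(1) m] by (simp add: d_def)
    have b: "?h ` box l u \<in> sets borel"
      unfolding vi[symmetric] using measurable_sets_borel[of g borel "box l u"] by simp
    have "emeasure lborel (?h ` box l u) = emeasure lebesgue (?h ` box l u)"
      using b by simp
    also have "\<dots> = ennreal (measure lebesgue (?h ` box l u))"
      using fmeasurableD2[OF m] by (intro emeasure_eq_ennreal_measure) simp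
    finally have "ennreal d * emeasure lborel (?h ` box l u) = ennreal (measure lebesgue (box l u))"
      unfolding me using ennreal_mult[of d "measure lebesgue (?h ` box l u)"] by (simp add: d_def)
    also have "\<dots> = ennreal (\<Prod>b\<in>Basis. (u - l) \<bullet> b)"
      using le by (simp add: measure_lborel_box_eq inner_diff_left)
    finally show "emeasure (density (distr lborel borel g) (\<lambda>_. ennreal d)) (box l u) = ennreal (\<Prod>b\<in>Basis. (u - l) \<bullet> b)"
      by (simp add: emeasure_density nn_integral_cmult_indicator emeasure_distr vi)
  qed simp
  then have "(\<integral>\<^sup>+x. f x \<partial>lborel) = (\<integral>\<^sup>+x. f x \<partial>density (distr lborel borel g) (\<lambda>_. ennreal d))"
    by simp
  also have "\<dots> = ennreal d * (\<integral>\<^sup>+x. f (g x) \<partial>lborel)"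
    using f by (simp add: nn_integral_density nn_integral_distr nn_integral_cmult)
  finally show ?thesis by (simp add: d_def)
qed

text \<open>Gram and Schmidt for the scalar product given by \<open>A\<close>: an orthonormal set of maximal size must be
a basis, since any vector outside its span could be orthogonalised against it and normalised.\<close>

lemma orthonormal_frame_exists:
  fixes A :: "real^'n^'n"
  assumes sym: "transpose A = A" and pos: "\<And>t. t \<noteq> 0 \<Longrightarrow> t \<bullet> (A *v t) > 0"
  obtains U :: "real^'n^'n" where "transpose U ** A ** U = mat 1"
proof -
  define B where "B = (\<lambda>x y. x \<bullet> (A *v y))"
  have Bsym: "B x y = B y x" for x y
    using dot_lmul_matrix[of x A y] transpose_matrix_vector[of A x]
    unfolding B_def by (simp add: sym inner_commute)
  have Badd: "B (x + y) z = B x z + B y z" "B (x - y) z = B x z - B y z" "B (r *\<^sub>R x) z = r * B x z"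
    for x y z r unfolding B_def by (auto simp: inner_simps)
  have Bsum: "B (sum f T) z = (\<Sum>t\<in>T. B (f t) z)" for f :: "real^'n \<Rightarrow> real^'n" and T z
    unfolding B_def by (simp add: inner_sum_left)
  define good where "good = (\<lambda>T. finite T \<and> (\<forall>x\<in>T. \<forall>y\<in>T. B x y = (if x = y then 1 else 0)))"
  have indep: "independent T" if "good T" for T
  proof (rule independent_if_scalars_zero)
    show "finite T" using that by (simp add: good_def)
    fix f x assume s: "(\<Sum>x\<in>T. f x *\<^sub>R x) = 0" and x: "x \<in> T"
    have "0 = B (\<Sum>x\<in>T. f x *\<^sub>R x) x" unfolding s by (simp add: B_def)
    also have "\<dots> = (\<Sum>y\<in>T. f y * (if y = x then 1 else 0))"
      unfolding Bsum using that x by (intro sum.cong) (auto simp: good_def Badd)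
    also have "\<dots> = f x"
      using that x by (simp add: good_def if_distrib[of "\<lambda>r. _ * r"] cong: if_cong)
    finally show "f x = 0" by simp
  qed
  have card: "card T \<le> CARD('n)" if "good T" for T
    using independent_bound[OF indep[OF that]] by simp
  have "good {}" by (simp add: good_def)
  then obtain T where T: "good T" "\<And>T'. good T' \<Longrightarrow> card T' \<le> card T"
    using ex_has_greatest_nat[of good "{}" card "Suc CARD('n)"] card by (meson less_Suc_eq_le)
  have "card T = CARD('n)"
  proof (rule ccontr)
    assume "card T \<noteq> CARD('n)"
    then have "dim (span T) < CARD('n)"
      using card[OF T(1)] indep[OF T(1)] by (simp add: dim_eq_card_independent)
    then have "span T \<noteq> UNIV" by (metis dim_span dim_UNIV DIM_cart DIM_real mult.right_neutral nless_le)
    then obtain x where x: "x \<notin> span T" by blast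
    define y where "y = x - (\<Sum>t\<in>T. B x t *\<^sub>R t)"
    have "y \<noteq> 0"
    proof
      assume "y = 0"
      then have "x = (\<Sum>t\<in>T. B x t *\<^sub>R t)" by (simp add: y_def)
      moreover have "(\<Sum>t\<in>T. B x t *\<^sub>R t) \<in> span T" by (intro span_sum span_scale span_base)
      ultimately show False using x by simp
    qed
    then have Byy: "B y y > 0" using pos by (simp add: B_def)
    have By: "B y s = 0" if s: "s \<in> T" for s
    proof -
      have "B y s = B x s - (\<Sum>t\<in>T. B x t * (if t = s then 1 else 0))"
        unfolding y_def Badd Bsum using T(1) s
        by (intro arg_cong2[where f="(-)"] refl sum.cong) (auto simp: good_def)
      then show ?thesis
        using T(1) s by (simp add: good_def if_distrib[of "\<lambda>r. _ * r"] cong: if_cong)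
    qed
    define z where "z = (1 / sqrt (B y y)) *\<^sub>R y"
    have Bzz: "B z z = 1"
    proof -
      have "B z z = (1 / sqrt (B y y)) * (1 / sqrt (B y y)) * B y y"
        unfolding z_def Badd by (subst Bsym) (simp add: Badd)
      then show ?thesis using Byy by (simp add: field_simps)
    qed
    have Bzs: "B z s = 0" "B s z = 0" if "s \<in> T" for s
      using By[OF that] Bsym[of s z] by (auto simp: z_def Badd)
    have zT: "z \<notin> T" using Bzz Bzs by fastforce
    have "good (insert z T)" using T(1) Bzz Bzs zT by (auto simp: good_def)
    from T(2)[OF this] show False using zT T(1) by (simp add: good_def)
  qed
  then obtain u where u: "bij_betw u (UNIV :: 'n set) T"
    using T(1) finite_same_card_bij[of "UNIV :: 'n set" T] by (auto simp: good_def)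
  define U where "U = (\<chi> i j. u j $ i)"
  have col: "column j U = u j" for j by (simp add: column_def U_def vec_eq_iff)
  have "(transpose U ** A ** U) $ i $ j = B (u i) (u j)" for i j
  proof -
    have "(transpose U ** A ** U) $ i $ j = ((transpose U ** A ** U) *v axis j 1) $ i"
      by (simp only: matrix_vector_mult_basis) (simp add: column_def)
    also have "\<dots> = (transpose U *v (A *v (U *v axis j 1))) $ i"
      by (simp only: matrix_vector_mul_assoc matrix_mul_assoc)
    also have "U *v axis j 1 = u j" by (simp add: matrix_vector_mult_basis col)
    finally show ?thesis
      by (simp add: B_def matrix_vector_mult_def transpose_def U_def inner_vec_def)
  qed
  moreover have "B (u i) (u j) = (if i = j then 1 else 0)" for i j
  proof -
    have "u i \<in> T" "u j \<in> T" "u i = u j \<longleftrightarrow> i = j"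
      using u by (auto simp: bij_betw_def inj_on_def)
    then show ?thesis using T(1) by (simp add: good_def)
  qed
  ultimately have "transpose U ** A ** U = mat 1" by (simp add: vec_eq_iff mat_def)
  then show ?thesis by (rule that)
qed

text \<open>The substitution \<open>t = U s\<close> with the columns of \<open>U\<close> orthonormal for \<open>A\<close> turns \<open>t \<bullet> A t\<close> into \<open>|s|\<^sup>2\<close>.
Its Jacobian is \<open>1/\<surd>(det A)\<close> because \<open>det U\<^sup>2 * det A = 1\<close>.\<close>

lemma gaussian_integral_quadratic_form:
  fixes A :: "real^'n::{finite,wellorder}^'n::_"
  assumes sym: "transpose A = A" and pos: "\<And>t. t \<noteq> 0 \<Longrightarrow> t \<bullet> (A *v t) > 0" and c: "c > 0"
  shows "det A > 0"
    and "has_bochner_integral lborel (\<lambda>t. exp (- c * (t \<bullet> (A *v t))))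
           ((pi / c) powr (real CARD('n) / 2) / sqrt (det A))"
proof -
  obtain U :: "real^'n::_^'n::_" where U: "transpose U ** A ** U = mat 1"
    by (rule orthonormal_frame_exists[OF sym pos])
  have "det (transpose U ** A ** U) = 1" using U by simp
  then have d: "(det U)\<^sup>2 * det A = 1" by (simp add: det_mul power2_eq_square algebra_simps)
  then have U0: "det U \<noteq> 0" by auto
  show A0: "det A > 0"
    using d by (metis zero_less_mult_pos zero_less_one zero_less_power2 U0)
  have absU: "\<bar>det U\<bar> = 1 / sqrt (det A)"
  proof -
    have "sqrt ((det U)\<^sup>2 * det A) = 1" using d by simp
    then have "\<bar>det U\<bar> * sqrt (det A) = 1" by (simp add: real_sqrt_mult)
    then show ?thesis using A0 by (simp add: field_simps)
  qed
  have q: "(U *v s) \<bullet> (A *v (U *v s)) = (norm s)\<^sup>2" for s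
  proof -
    have "U *v s = s v* transpose U" using transpose_matrix_vector[of "transpose U" s] by simp
    then have "(U *v s) \<bullet> (A *v (U *v s)) = s \<bullet> (transpose U *v (A *v (U *v s)))"
      by (simp only: dot_lmul_matrix)
    also have "\<dots> = s \<bullet> ((transpose U ** A ** U) *v s)"
      by (simp only: matrix_vector_mul_assoc matrix_mul_assoc)
    finally show ?thesis by (simp add: U power2_norm_eq_inner)
  qed
  have bij: "bij ((*v) U)" using U0 by (metis invertible_det_nz invertible_eq_bij)
  have cont: "continuous_on UNIV (\<lambda>t. exp (- c * (t \<bullet> (A *v t))))"
    by (intro continuous_intros linear_continuous_on) (simp add: linear_linear[symmetric])
  have "(\<integral>\<^sup>+t. ennreal (exp (- c * (t \<bullet> (A *v t)))) \<partial>lborel)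
      = ennreal \<bar>det (matrix ((*v) U))\<bar> * (\<integral>\<^sup>+s. ennreal (exp (- c * (norm (s :: real^'n::_))\<^sup>2)) \<partial>lborel)"
    using borel_measurable_continuous_onI[OF cont]
    by (subst nn_integral_linear_cart[OF _ bij]) (auto simp: q)
  also have "\<dots> = ennreal (1 / sqrt (det A)) * ennreal ((pi / c) powr (real CARD('n) / 2))"
    unfolding gaussian_integral_norm[OF c] by (simp add: absU)
  also have "\<dots> = ennreal ((pi / c) powr (real CARD('n) / 2) / sqrt (det A))"
    using A0 by (subst ennreal_mult[symmetric]) auto
  finally show "has_bochner_integral lborel (\<lambda>t. exp (- c * (t \<bullet> (A *v t))))
           ((pi / c) powr (real CARD('n) / 2) / sqrt (det A))"
    using borel_measurable_continuous_onI[OF cont] A0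
    by (intro has_bochner_integral_nn_integral) auto
qed

section \<open>Characters of the torus\<close>

definition circle_exp :: "real \<Rightarrow> complex" where "circle_exp x = cis (2 * pi * x)"

lemma circle_exp_add: "circle_exp (x + y) = circle_exp x * circle_exp y"
  by (simp add: circle_exp_def cis_mult distrib_left)

lemma circle_exp_0 [simp]: "circle_exp 0 = 1" by (simp add: circle_exp_def)

lemma norm_circle_exp [simp]: "norm (circle_exp x) = 1" by (simp add: circle_exp_def)

lemma circle_exp_sum: "finite I \<Longrightarrow> circle_exp (sum f I) = (\<Prod>i\<in>I. circle_exp (f i))"
  by (induction I rule: finite_induct) (auto simp: circle_exp_add)

lemma Re_circle_exp_eq_1_iff: "Re (circle_exp x) = 1 \<longleftrightarrow> x \<in> \<int>"
proof -
  have "Re (circle_exp x) = 1 \<longleftrightarrow> (\<exists>n::int. 2 * pi * x = of_int n * 2 * pi)"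
    by (simp add: circle_exp_def cos_one_2pi_int)
  also have "\<dots> \<longleftrightarrow> (\<exists>n::int. x = of_int n)"
    by (intro ex_cong1) auto
  finally show ?thesis by (auto elim: Ints_cases)
qed

lemma circle_exp_int: "x \<in> \<int> \<Longrightarrow> circle_exp x = 1"
  by (simp add: circle_exp_def)

lemma circle_exp_eq_1_iff: "circle_exp x = 1 \<longleftrightarrow> x \<in> \<int>"
  using Re_circle_exp_eq_1_iff[of x] circle_exp_int[of x] by auto

lemma circle_exp_near_0:
  "\<bar>Re (circle_exp x) - 1\<bar> \<le> 2 * pi\<^sup>2 * x\<^sup>2" "\<bar>Im (circle_exp x)\<bar> \<le> 2 * pi * \<bar>x\<bar>"
proof -
  have "\<bar>Re (circle_exp x) - 1\<bar> = 2 * (sin (pi * x))\<^sup>2"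
    using cos_double_sin[of "pi * x"] by (simp add: circle_exp_def mult.assoc)
  also have "\<dots> \<le> 2 * (pi * x)\<^sup>2"
    using abs_sin_x_le_abs_x[of "pi * x"] by (simp add: abs_le_square_iff)
  finally show "\<bar>Re (circle_exp x) - 1\<bar> \<le> 2 * pi\<^sup>2 * x\<^sup>2" by (simp add: power_mult_distrib)
  show "\<bar>Im (circle_exp x)\<bar> \<le> 2 * pi * \<bar>x\<bar>"
    using abs_sin_x_le_abs_x[of "2 * pi * x"] by (simp add: circle_exp_def abs_mult)
qed

lemma has_vector_derivative_circle_exp:
  "((\<lambda>s. circle_exp (k * (s + a))) has_vector_derivative (2 * pi * k * \<i> * circle_exp (k * (s + a)))) (at s within X)"
proof -
  have "((\<lambda>z. exp (2 * pi * k * \<i> * (z + of_real a))) has_field_derivative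
          (2 * pi * k * \<i> * exp (2 * pi * k * \<i> * (of_real s + of_real a)))) (at (of_real s))"
    by (auto intro!: derivative_eq_intros)
  from has_vector_derivative_real_field[OF this]
  show ?thesis by (simp add: circle_exp_def cis_conv_exp mult_ac)
qed

lemma continuous_on_circle_exp: "continuous_on X f \<Longrightarrow> continuous_on X (\<lambda>x. circle_exp (f x))"
  unfolding circle_exp_def cis_conv_exp by (intro continuous_intros)

lemma has_bochner_integral_prod_cart:
  fixes f :: "'n::finite \<Rightarrow> real \<Rightarrow> complex"
  assumes f: "\<And>i. has_bochner_integral lborel (f i) (r i)"
  shows "has_bochner_integral lborel (\<lambda>x::real^'n. \<Prod>i\<in>UNIV. f i (x $ i)) (\<Prod>i\<in>UNIV. r i)"
proof -
  interpret product_sigma_finite "\<lambda>_ :: real^'n. lborel :: real measure" ..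
  let ?M = "\<Pi>\<^sub>M b\<in>(Basis :: (real^'n) set). (lborel :: real measure)"
  let ?T = "\<lambda>f. \<Sum>b\<in>(Basis :: (real^'n) set). f b *\<^sub>R b"
  let ?h = "\<lambda>b :: real^'n. f (axis_index b)"
  have int: "integrable lborel (?h b)" and val: "integral\<^sup>L lborel (?h b) = r (axis_index b)" for b
    using f[of "axis_index b"] by (auto simp: has_bochner_integral_iff)
  have eq: "(\<Prod>i\<in>UNIV. f i (?T y $ i)) = (\<Prod>b\<in>Basis. ?h b (y b))" for y
  proof -
    have "?T y \<bullet> axis i 1 = y (axis i 1)" for i
      by (subst inner_sum_left_Basis) auto
    then show ?thesis unfolding prod_Basis_cart by (simp add: inner_axis)
  qed
  have T[measurable]: "?T \<in> borel_measurable ?M" by measurable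
  have [measurable]: "f i \<in> borel_measurable borel" for i
    using f[of i] by (auto simp: has_bochner_integral_iff dest: borel_measurable_integrable)
  have meas: "(\<lambda>x::real^'n. \<Prod>i\<in>UNIV. f i (x $ i)) \<in> borel_measurable borel"
    by measurable
  have "integrable ?M (\<lambda>y. \<Prod>i\<in>UNIV. f i (?T y $ i))"
    unfolding eq by (intro product_integrable_prod int) auto
  then have 1: "integrable lborel (\<lambda>x::real^'n. \<Prod>i\<in>UNIV. f i (x $ i))"
    by (subst lborel_eq) (simp add: integrable_distr_eq[OF T meas])
  have "(\<integral>x. (\<Prod>i\<in>UNIV. f i (x $ i)) \<partial>(lborel :: (real^'n) measure))
      = (\<integral>y. (\<Prod>i\<in>UNIV. f i (?T y $ i)) \<partial>?M)"
    by (subst lborel_eq) (simp add: integral_distr[OF T meas])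
  also have "\<dots> = (\<Prod>b\<in>(Basis :: (real^'n) set). integral\<^sup>L lborel (?h b))"
    unfolding eq by (intro product_integral_prod int) auto
  also have "\<dots> = (\<Prod>i\<in>UNIV. r i)"
    unfolding val prod_Basis_cart by simp
  finally show ?thesis using 1 by (simp add: has_bochner_integral_iff)
qed

text \<open>The \<open>q\<close> translates of the interval cover one full period of a character of \<open>\<real>/\<int>\<close>. The integrals
over them are differences of an antiderivative at adjacent end points, so the sum telescopes to the
increment of a 1-periodic function over a period.\<close>

lemma integral_shifted_characters_real:
  fixes k :: real and q :: nat
  assumes q: "q > 0" and k: "k \<in> \<int>"
  shows "has_bochner_integral lborel
     (\<lambda>s. indicator {- 1 / (2 * real q) .. 1 / (2 * real q)} s *\<^sub>R (\<Sum>j<q. circle_exp (k * (s + real j / real q))))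
     (if k = 0 then 1 else 0)"
proof (cases "k = 0")
  case True
  have "has_bochner_integral lborel (\<lambda>s. indicator {- 1 / (2 * real q) .. 1 / (2 * real q)} s *\<^sub>R (of_nat q :: complex))
     (of_real (real q * (1 / (2 * real q))) - of_real (real q * (- 1 / (2 * real q))))"
  proof (intro has_bochner_integral_FTC_Icc)
    show "- 1 / (2 * real q) \<le> 1 / (2 * real q)" using q by simp
    show "((\<lambda>s. of_real (real q * s)) has_vector_derivative (of_nat q :: complex)) (at x within X)" for x X
      using has_vector_derivative_of_real[OF DERIV_cmult_Id[of "real q" x X], where 'a=complex] by simp
  qed simp
  moreover have "(of_real (real q * (1 / (2 * real q))) - of_real (real q * (- 1 / (2 * real q))) :: complex) = 1"
    using q by (subst of_real_diff[symmetric]) simp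
  ultimately show ?thesis using True by simp
next
  case False
  define G where "G = (\<lambda>s. circle_exp (k * s) / (2 * pi * k * \<i>))"
  define F where "F = (\<lambda>s. \<Sum>j<q. G (s + real j / real q))"
  have dF: "(F has_vector_derivative (\<Sum>j<q. circle_exp (k * (s + real j / real q)))) (at s within X)" for s X
    unfolding F_def G_def
  proof (rule has_vector_derivative_sum)
    fix j
    have "((\<lambda>s. circle_exp (k * (s + real j / real q)) / (2 * pi * k * \<i>)) has_vector_derivative
            (2 * pi * k * \<i> * circle_exp (k * (s + real j / real q))) / (2 * pi * k * \<i>)) (at s within X)"
      by (intro has_vector_derivative_divide has_vector_derivative_circle_exp)
    then show "((\<lambda>s. circle_exp (k * (s + real j / real q)) / (2 * pi * k * \<i>)) has_vector_derivative
            circle_exp (k * (s + real j / real q))) (at s within X)"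
      using False by simp
  qed
  have "has_bochner_integral lborel
     (\<lambda>s. indicator {- 1 / (2 * real q) .. 1 / (2 * real q)} s *\<^sub>R (\<Sum>j<q. circle_exp (k * (s + real j / real q))))
     (F (1 / (2 * real q)) - F (- 1 / (2 * real q)))"
    by (intro has_bochner_integral_FTC_Icc dF continuous_intros continuous_on_circle_exp) (use q in auto)
  moreover have "F (1 / (2 * real q)) - F (- 1 / (2 * real q)) = 0"
  proof -
    define a where "a = (\<lambda>j. G (real j / real q - 1 / (2 * real q)))"
    have "F (1 / (2 * real q)) - F (- 1 / (2 * real q)) = (\<Sum>j<q. a (Suc j) - a j)"
      unfolding F_def sum_subtractf[symmetric]
    proof (rule sum.cong)
      fix j
      have "1 / (2 * real q) + real j / real q = real (Suc j) / real q - 1 / (2 * real q)"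
        using q by (simp add: field_simps)
      moreover have "- 1 / (2 * real q) + real j / real q = real j / real q - 1 / (2 * real q)"
        by simp
      ultimately show "G (1 / (2 * real q) + real j / real q) - G (- 1 / (2 * real q) + real j / real q) = a (Suc j) - a j"
        by (simp only: a_def)
    qed simp
    also have "\<dots> = a q - a 0" by (rule sum_lessThan_telescope)
    also have "\<dots> = 0"
    proof -
      have "circle_exp (k * (1 - 1 / (2 * real q))) = circle_exp k * circle_exp (k * (- 1 / (2 * real q)))"
        by (simp add: circle_exp_add[symmetric] algebra_simps)
      then show ?thesis using q circle_exp_int[OF k] by (simp add: a_def G_def)
    qed
    finally show ?thesis .
  qed
  ultimately show ?thesis using False by simp
qed

text \<open>The translates of \<open>cube q\<close> by the points of \<open>grid q\<close> tile a fundamental domain of \<open>\<int>\<^sup>n\<close>. Centring the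
cubes at the grid points keeps every point of \<open>\<int>\<^sup>n / q\<close> off the boundaries.\<close>

definition grid :: "nat \<Rightarrow> (real^'n) set"
  where "grid q = {t. \<forall>i. t $ i \<in> (\<lambda>j. real j / real q) ` {..<q}}"

definition cube :: "nat \<Rightarrow> (real^'n) set"
  where "cube q = cbox (\<chi> i. - 1 / (2 * real q)) (\<chi> i. 1 / (2 * real q))"

lemma grid_eq_image: "grid q = vec_lambda ` (\<Pi>\<^sub>E i\<in>(UNIV :: 'n::finite set). (\<lambda>j. real j / real q) ` {..<q})"
proof -
  have "t \<in> vec_lambda ` (UNIV \<rightarrow> (\<lambda>j. real j / real q) ` {..<q})" if "t \<in> grid q" for t :: "real^'n"
    using that by (intro image_eqI[of _ _ "\<lambda>i. t $ i"]) (auto simp: grid_def)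
  moreover have "vec_lambda f \<in> grid q" if "f \<in> UNIV \<rightarrow> (\<lambda>j. real j / real q) ` {..<q}"
    for f :: "'n \<Rightarrow> real"
    using that by (auto simp: grid_def Pi_iff)
  ultimately show ?thesis unfolding PiE_UNIV_domain by blast
qed

lemma finite_grid: "finite (grid q :: (real^'n) set)"
  unfolding grid_eq_image by (intro finite_imageI finite_PiE) auto

lemma sum_grid_prod:
  fixes F :: "'n::finite \<Rightarrow> real \<Rightarrow> complex"
  assumes "q > 0"
  shows "(\<Sum>t\<in>grid q. \<Prod>i\<in>UNIV. F i (t $ i)) = (\<Prod>i\<in>UNIV. \<Sum>j<q. F i (real j / real q))"
proof -
  have inj: "inj_on (\<lambda>j. real j / real q) {..<q}" using assms by (auto simp: inj_on_def)
  have "(\<Prod>i\<in>UNIV. \<Sum>j<q. F i (real j / real q)) = (\<Prod>i\<in>UNIV. \<Sum>x\<in>(\<lambda>j. real j / real q) ` {..<q}. F i x)"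
    by (simp add: sum.reindex[OF inj])
  also have "\<dots> = (\<Sum>g\<in>(\<Pi>\<^sub>E i\<in>UNIV. (\<lambda>j. real j / real q) ` {..<q}). \<Prod>i\<in>UNIV. F i (g i))"
    by (intro prod_sum_PiE) auto
  also have "\<dots> = (\<Sum>t\<in>grid q. \<Prod>i\<in>UNIV. F i (t $ i))"
    unfolding grid_eq_image by (subst sum.reindex) (auto simp: inj_on_def)
  finally show ?thesis by simp
qed

lemma indicator_cube: "indicator (cube q) x = (\<Prod>i\<in>UNIV. indicator {- 1 / (2 * real q) .. 1 / (2 * real q)} (x $ i) :: real)"
proof (cases "x \<in> cube q")
  case True
  then show ?thesis by (auto simp: cube_def mem_box_cart)
next
  case False
  then obtain i where "x $ i \<notin> {- 1 / (2 * real q) .. 1 / (2 * real q)}" by (auto simp: cube_def mem_box_cart)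
  then have "(\<Prod>i\<in>UNIV. indicator {- 1 / (2 * real q) .. 1 / (2 * real q)} (x $ i) :: real) = 0"
    by (intro prod_zero bexI[of _ i]) auto
  then show ?thesis using False by simp
qed

lemma orthogonality_shifted_cubes:
  fixes v :: "real^'n"
  assumes q: "q > 0" and v: "\<And>i. v $ i \<in> \<int>"
  shows "has_bochner_integral lborel (\<lambda>t. indicator (cube q) t *\<^sub>R (\<Sum>k\<in>grid q. circle_exp (v \<bullet> (t + k))))
           (if v = 0 then 1 else 0)"
proof -
  let ?I = "{- 1 / (2 * real q) .. 1 / (2 * real q)}"
  have "has_bochner_integral lborel
      (\<lambda>t::real^'n. \<Prod>i\<in>UNIV. indicator ?I (t $ i) *\<^sub>R (\<Sum>j<q. circle_exp (v $ i * (t $ i + real j / real q))))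
      (\<Prod>i\<in>UNIV. if v $ i = 0 then 1 else 0)"
    by (intro has_bochner_integral_prod_cart integral_shifted_characters_real q v)
  moreover have "(\<Prod>i\<in>UNIV. indicator ?I (t $ i) *\<^sub>R (\<Sum>j<q. circle_exp (v $ i * (t $ i + real j / real q))))
      = indicator (cube q) t *\<^sub>R (\<Sum>k\<in>grid q. circle_exp (v \<bullet> (t + k)))" for t
  proof -
    have "circle_exp (v \<bullet> (t + k)) = (\<Prod>i\<in>UNIV. circle_exp (v $ i * (t $ i + k $ i)))" for k
      by (simp add: inner_vec_def circle_exp_sum)
    then show ?thesis
      by (simp add: sum_grid_prod[OF q, of "\<lambda>i x. circle_exp (v $ i * (t $ i + x))"] indicator_cube
            scaleR_conv_of_real prod.distrib)
  qed
  moreover have "(\<Prod>i\<in>UNIV. if v $ i = 0 then 1 else 0 :: complex) = (if v = 0 then 1 else 0)"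
    by (auto simp: vec_eq_iff intro!: prod_zero)
  ultimately show ?thesis by simp
qed

lemma zero_in_grid: "q > 0 \<Longrightarrow> 0 \<in> grid q"
  by (auto simp: grid_def image_iff intro!: bexI[of _ 0])

section \<open>Elementary estimates\<close>

lemma power_le_exp:
  fixes x d :: real assumes "x \<ge> 0" "d > 0" "k > 0"
  shows "x ^ k \<le> (real k / d) ^ k * exp (d * x)"
proof -
  have "(d * x / real k) ^ k \<le> exp (d * x / real k) ^ k"
  proof (intro power_mono)
    show "d * x / real k \<le> exp (d * x / real k)"
      using exp_ge_add_one_self[of "d * x / real k"] by linarith
  qed (use assms in simp)
  also have "\<dots> = exp (d * x)" using assms by (simp flip: exp_of_nat_mult)
  finally have "(real k / d) ^ k * (d * x / real k) ^ k \<le> (real k / d) ^ k * exp (d * x)"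
    using assms by (intro mult_left_mono) auto
  then show ?thesis using assms by (simp flip: power_mult_distrib)
qed

text \<open>A Taylor formula of second order for \<open>a ^ N\<close> about \<open>b\<close>. The factor \<open>M\<^sup>2\<close> on the left stands for the
exponent \<open>N - 2\<close> of \<open>M\<close>, which would be truncated for small \<open>N\<close>.\<close>

lemma power_second_order:
  fixes a b :: complex and M :: real
  assumes a: "norm a \<le> M" and b: "norm b \<le> M"
  shows "norm (a ^ N - b ^ N - of_nat N * b ^ (N - 1) * (a - b)) * M\<^sup>2 \<le> (real N)\<^sup>2 * M ^ N * (norm (a - b))\<^sup>2"
proof (induction N)
  case 0
  then show ?case by simp
next
  case (Suc n)
  define D where "D = a ^ n - b ^ n - of_nat n * b ^ (n - 1) * (a - b)"
  have M: "M \<ge> 0" using a norm_ge_zero order_trans by blast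
  have eq: "a ^ Suc n - b ^ Suc n - of_nat (Suc n) * b ^ (Suc n - 1) * (a - b)
      = a * D + of_nat n * b ^ (n - 1) * (a - b)\<^sup>2"
    unfolding D_def by (cases n) (simp_all add: algebra_simps power2_eq_square)
  have 1: "norm (a * D) * M\<^sup>2 \<le> M * ((real n)\<^sup>2 * M ^ n * (norm (a - b))\<^sup>2)"
    using mult_mono[OF a Suc.IH[folded D_def]] M by (simp add: norm_mult mult.assoc)
  have 2: "norm (of_nat n * b ^ (n - 1) * (a - b)\<^sup>2) * M\<^sup>2 \<le> real n * M ^ Suc n * (norm (a - b))\<^sup>2"
  proof (cases n)
    case (Suc m)
    have "norm b ^ m \<le> M ^ m" using b by (intro power_mono) auto
    then have "real n * norm b ^ m * (norm (a - b))\<^sup>2 * M\<^sup>2 \<le> real n * M ^ m * (norm (a - b))\<^sup>2 * M\<^sup>2"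
      by (intro mult_right_mono mult_left_mono) auto
    then show ?thesis
      unfolding Suc by (simp add: norm_mult norm_power power2_eq_square mult_ac del: of_nat_Suc)
  qed simp
  have "norm (a * D + of_nat n * b ^ (n - 1) * (a - b)\<^sup>2) * M\<^sup>2
      \<le> (norm (a * D) + norm (of_nat n * b ^ (n - 1) * (a - b)\<^sup>2)) * M\<^sup>2"
    by (intro mult_right_mono norm_triangle_ineq) auto
  also have "\<dots> \<le> M * ((real n)\<^sup>2 * M ^ n * (norm (a - b))\<^sup>2) + real n * M ^ Suc n * (norm (a - b))\<^sup>2"
    unfolding distrib_right by (intro add_mono 1 2)
  also have "\<dots> = ((real n)\<^sup>2 + real n) * (M ^ Suc n * (norm (a - b))\<^sup>2)"
    by (simp add: algebra_simps)
  also have "\<dots> \<le> (real (Suc n))\<^sup>2 * (M ^ Suc n * (norm (a - b))\<^sup>2)"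
    using M by (intro mult_right_mono) (auto simp: power2_eq_square algebra_simps)
  finally show ?case unfolding eq by (simp add: mult_ac)
qed

text \<open>The analytic core. Think of \<open>a\<close> as the characteristic function at distance \<open>r\<close> from the origin, of
\<open>b\<close> as its Gaussian approximation and of \<open>\<gamma>\<close> as a character. With \<open>u = a - b\<close>, the second-order
remainder of \<open>a ^ N\<close> is of size \<open>N\<^sup>2 r\<^sup>6\<close>. In the first-order term only the real part of \<open>\<gamma> * u\<close>
counts; the part of \<open>u\<close> of order \<open>r\<^sup>3\<close> is imaginary, so it enters this real part only against the imaginary
part of \<open>\<gamma>\<close>, which leaves \<open>N r\<^sup>4\<close>. All terms are \<open>1/N\<close> times a power of \<open>x = N r\<^sup>2\<close>, and powers of
\<open>x\<close> are absorbed by half of the exponential decay.\<close>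

lemma power_vs_gaussian:
  fixes R D c :: real
  assumes R: "R \<ge> 0" and D: "D \<ge> 0" and c: "c > 0"
  obtains C where "C \<ge> 0"
    "\<And>(a :: complex) \<gamma> b r N. \<lbrakk>N > 0; 0 \<le> r; r \<le> R; \<bar>Re a - b\<bar> \<le> D * r ^ 4; \<bar>Im a\<bar> \<le> D * r ^ 3;
       \<bar>Re \<gamma> - 1\<bar> \<le> D * r\<^sup>2; \<bar>Im \<gamma>\<bar> \<le> D * r; norm \<gamma> \<le> 1;
       norm a \<le> exp (- c * r\<^sup>2); 0 \<le> b; b \<le> exp (- c * r\<^sup>2)\<rbrakk>
     \<Longrightarrow> \<bar>Re (\<gamma> * a ^ N) - b ^ N\<bar> \<le> C / real N * exp (- (c / 2) * (real N * r\<^sup>2))"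
proof -
  define K1 where "K1 = exp (2 * c * R\<^sup>2) * (D * (R + 1))\<^sup>2"
  define K2 where "K2 = exp (c * R\<^sup>2) * (D + D\<^sup>2)"
  define B where "B = (3 / (c/2)) ^ 3 + (2 / (c/2)) ^ 2 + (1 / (c/2)) ^ 1"
  define C where "C = (K1 + K2 + D) * B"
  have K: "K1 \<ge> 0" "K2 \<ge> 0" "B \<ge> 0" using R D c by (auto simp: K1_def K2_def B_def)
  have B: "x ^ 3 + x\<^sup>2 + x \<le> B * exp ((c/2) * x)" if "x \<ge> 0" for x
    using power_le_exp[OF that, of "c/2" 3] power_le_exp[OF that, of "c/2" 2]
      power_le_exp[OF that, of "c/2" 1] c unfolding B_def by (simp add: distrib_right)
  have "\<bar>Re (\<gamma> * a ^ N) - b ^ N\<bar> \<le> C / real N * exp (- (c / 2) * (real N * r\<^sup>2))"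
    if N: "N > 0" and r: "0 \<le> r" "r \<le> R" and a1: "\<bar>Re a - b\<bar> \<le> D * r ^ 4" and a2: "\<bar>Im a\<bar> \<le> D * r ^ 3"
      and g1: "\<bar>Re \<gamma> - 1\<bar> \<le> D * r\<^sup>2" and g2: "\<bar>Im \<gamma>\<bar> \<le> D * r" and g3: "norm \<gamma> \<le> 1"
      and a3: "norm a \<le> exp (- c * r\<^sup>2)" and b: "0 \<le> b" "b \<le> exp (- c * r\<^sup>2)"
    for a \<gamma> :: complex and b r :: real and N :: nat
  proof -
    define M where "M = exp (- c * r\<^sup>2)"
    define u where "u = a - of_real b"
    define x where "x = real N * r\<^sup>2"
    have x: "x \<ge> 0" by (simp add: x_def)
    have M: "M > 0" by (simp add: M_def)
    have MN: "M ^ N = exp (- c * x)" by (simp add: M_def x_def mult_ac flip: exp_of_nat_mult)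
    have rR: "r\<^sup>2 \<le> R\<^sup>2" using r by (intro power_mono) auto
    have Minv: "1 / M \<le> exp (c * R\<^sup>2)"
      using rR c by (simp add: M_def exp_minus field_simps)
    have Minv2: "1 / M\<^sup>2 \<le> exp (2 * c * R\<^sup>2)"
    proof -
      have "1 / M\<^sup>2 = (1 / M)\<^sup>2" by (simp add: power_divide)
      also have "\<dots> \<le> exp (c * R\<^sup>2) ^ 2" using Minv M by (intro power_mono) auto
      also have "\<dots> = exp (2 * c * R\<^sup>2)" by (simp add: mult_ac flip: exp_of_nat_mult)
      finally show ?thesis .
    qed
    define E where "E = a ^ N - of_real b ^ N - of_nat N * of_real b ^ (N - 1) * u"
    have nu: "norm u \<le> D * (R + 1) * r ^ 3"
    proof -
      have "norm u \<le> \<bar>Re u\<bar> + \<bar>Im u\<bar>" by (rule cmod_le)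
      also have "\<dots> \<le> D * r ^ 4 + D * r ^ 3" using a1 a2 by (simp add: u_def)
      also have "D * r ^ 4 \<le> D * (R * r ^ 3)"
        using r D mult_right_mono[of r R "r ^ 3"] by (intro mult_left_mono) (simp_all add: power_Suc numeral_eq_Suc)
      finally show ?thesis by (simp add: algebra_simps)
    qed
    have E: "norm E \<le> K1 * ((real N)\<^sup>2 * r ^ 6) * M ^ N"
    proof -
      have "norm E * M\<^sup>2 \<le> (real N)\<^sup>2 * M ^ N * (norm u)\<^sup>2"
        unfolding E_def u_def using a3 b by (intro power_second_order) (auto simp: M_def)
      then have "norm E \<le> (real N)\<^sup>2 * M ^ N * (norm u)\<^sup>2 * (1 / M\<^sup>2)"
        using M by (simp add: field_simps)
      also have "\<dots> \<le> (real N)\<^sup>2 * M ^ N * (D * (R + 1) * r ^ 3)\<^sup>2 * exp (2 * c * R\<^sup>2)"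
        using Minv2 nu M r D R by (intro mult_mono power_mono) auto
      also have "\<dots> = K1 * ((real N)\<^sup>2 * r ^ 6) * M ^ N"
        by (simp add: K1_def power_mult_distrib mult_ac flip: power_mult)
      finally show ?thesis .
    qed
    have T2: "\<bar>real N * b ^ (N - 1) * Re (\<gamma> * u)\<bar> \<le> K2 * (real N * r ^ 4) * M ^ N"
    proof -
      have "\<bar>Re (\<gamma> * u)\<bar> \<le> \<bar>Re \<gamma>\<bar> * \<bar>Re u\<bar> + \<bar>Im \<gamma>\<bar> * \<bar>Im u\<bar>"
        by (simp add: abs_mult[symmetric])
      also have "\<dots> \<le> 1 * (D * r ^ 4) + (D * r) * (D * r ^ 3)"
        using a1 a2 g2 order_trans[OF abs_Re_le_cmod g3] D r
        by (intro add_mono mult_mono) (auto simp: u_def)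
      also have "\<dots> = (D + D\<^sup>2) * r ^ 4" by (simp add: algebra_simps power2_eq_square numeral_eq_Suc)
      finally have 1: "\<bar>Re (\<gamma> * u)\<bar> \<le> (D + D\<^sup>2) * r ^ 4" .
      have 2: "b ^ (N - 1) \<le> M ^ N * exp (c * R\<^sup>2)"
      proof -
        have "b ^ (N - 1) \<le> M ^ (N - 1)" using b by (intro power_mono) (auto simp: M_def)
        also have "\<dots> = M ^ N * (1 / M)" using N M by (cases N) auto
        also have "\<dots> \<le> M ^ N * exp (c * R\<^sup>2)" using Minv M by (intro mult_left_mono) auto
        finally show ?thesis .
      qed
      have "\<bar>real N * b ^ (N - 1) * Re (\<gamma> * u)\<bar> = real N * b ^ (N - 1) * \<bar>Re (\<gamma> * u)\<bar>"
        using b by (simp add: abs_mult)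
      also have "\<dots> \<le> real N * (M ^ N * exp (c * R\<^sup>2)) * ((D + D\<^sup>2) * r ^ 4)"
        using 1 2 b M by (intro mult_mono) auto
      finally show ?thesis by (simp add: K2_def mult_ac)
    qed
    have T3: "\<bar>b ^ N * (Re \<gamma> - 1)\<bar> \<le> D * r\<^sup>2 * M ^ N"
    proof -
      have "\<bar>b ^ N * (Re \<gamma> - 1)\<bar> = b ^ N * \<bar>Re \<gamma> - 1\<bar>" using b by (simp add: abs_mult)
      also have "\<dots> \<le> M ^ N * (D * r\<^sup>2)"
        using g1 b M by (intro mult_mono power_mono) (auto simp: M_def)
      finally show ?thesis by (simp add: mult_ac)
    qed
    have "\<gamma> * a ^ N = \<gamma> * E + of_real (real N * b ^ (N - 1)) * (\<gamma> * u) + of_real (b ^ N) * \<gamma>"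
      by (simp add: E_def algebra_simps)
    then have "Re (\<gamma> * a ^ N) - b ^ N = Re (\<gamma> * E) + real N * b ^ (N - 1) * Re (\<gamma> * u) + b ^ N * (Re \<gamma> - 1)"
      by (simp add: algebra_simps del: of_real_power of_real_mult)
    moreover have "\<bar>Re (\<gamma> * E)\<bar> \<le> norm E"
      using abs_Re_le_cmod[of "\<gamma> * E"] mult_right_mono[OF g3, of "norm E"] by (simp add: norm_mult)
    ultimately have "\<bar>Re (\<gamma> * a ^ N) - b ^ N\<bar>
        \<le> K1 * ((real N)\<^sup>2 * r ^ 6) * M ^ N + K2 * (real N * r ^ 4) * M ^ N + D * r\<^sup>2 * M ^ N"
      using E T2 T3 by linarith
    also have "\<dots> = (K1 * x ^ 3 + K2 * x\<^sup>2 + D * x) * (M ^ N / real N)"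
    proof -
      have "(real N)\<^sup>2 * r ^ 6 = x ^ 3 / real N" "real N * r ^ 4 = x\<^sup>2 / real N" "r\<^sup>2 = x / real N"
        using N by (auto simp: x_def field_simps numeral_eq_Suc)
      then show ?thesis by (simp add: add_divide_distrib distrib_right)
    qed
    also have "\<dots> \<le> ((K1 + K2 + D) * (x ^ 3 + x\<^sup>2 + x)) * (M ^ N / real N)"
      using K D x M by (intro mult_right_mono) (auto simp: algebra_simps intro!: add_nonneg_nonneg)
    also have "\<dots> \<le> ((K1 + K2 + D) * (B * exp ((c/2) * x))) * (M ^ N / real N)"
      using K D x M B[OF x] by (intro mult_right_mono mult_left_mono) auto
    also have "\<dots> = C / real N * (exp ((c/2) * x) * exp (- c * x))"
      by (simp add: C_def MN)
    also have "exp ((c/2) * x) * exp (- c * x) = exp (- (c / 2) * x)"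
      by (simp add: field_simps flip: exp_add)
    finally show ?thesis by (simp only: x_def)
  qed
  moreover have "C \<ge> 0" using K D by (simp add: C_def)
  ultimately show ?thesis using that by blast
qed

lemma compact_bound_below_1:
  fixes f :: "'a::topological_space \<Rightarrow> real"
  assumes "compact K" "continuous_on K f" "\<And>x. x \<in> K \<Longrightarrow> f x < 1"
  obtains s where "0 < s" "s < 1" "\<And>x. x \<in> K \<Longrightarrow> f x \<le> s"
proof (cases "K = {}")
  case False
  then obtain x where x: "x \<in> K" "\<And>y. y \<in> K \<Longrightarrow> f y \<le> f x"
    using continuous_attains_sup[OF assms(1) False assms(2)] by blast
  show ?thesis
  proof (rule that[of "max (1/2) (f x)"])
    show "f y \<le> max (1/2) (f x)" if "y \<in> K" for y using x(2)[OF that] by simp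
  qed (use assms(3)[OF x(1)] in auto)
qed (auto intro: that[of "1/2"])

lemma cos_quadratic_bound: "\<bar>cos y - (1 - y\<^sup>2 / 2)\<bar> \<le> \<bar>y\<bar> ^ 4 / 24" for y :: real
proof -
  obtain t where "cos y = (\<Sum>m<4. cos_coeff m * y ^ m) + (cos (t + 1/2 * real 4 * pi) / fact 4) * y ^ 4"
    using Maclaurin_cos_expansion[of y 4] by blast
  then have eq: "cos y - (1 - y\<^sup>2 / 2) = cos (t + 1/2 * real 4 * pi) / 24 * y ^ 4"
    by (simp add: eval_nat_numeral cos_coeff_Suc sin_coeff_Suc)
  have "\<bar>cos (t + 1/2 * real 4 * pi)\<bar> / 24 * \<bar>y\<bar> ^ 4 \<le> 1 / 24 * \<bar>y\<bar> ^ 4"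
    by (intro mult_right_mono divide_right_mono abs_cos_le_one) auto
  then show ?thesis unfolding eq abs_mult power_abs abs_divide by simp
qed

lemma sin_linear_bound: "\<bar>sin y - y\<bar> \<le> \<bar>y\<bar> ^ 3 / 6" for y :: real
  using Maclaurin_sin_bound[of y 3] by (simp add: eval_nat_numeral cos_coeff_Suc sin_coeff_Suc)

lemma exp_minus_bounds:
  fixes x :: real assumes "x \<ge> 0"
  shows "1 - x \<le> exp (- x)" "exp (- x) \<le> 1 - x + x\<^sup>2 / 2"
proof -
  show "1 - x \<le> exp (- x)" using exp_ge_add_one_self[of "- x"] by simp
  have "\<exists>t. \<bar>t\<bar> \<le> \<bar>- x\<bar> \<and> exp (- x) = (\<Sum>m<3. (- x) ^ m / fact m) + exp t / fact 3 * (- x) ^ 3"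
    by (rule Maclaurin_exp_le)
  then obtain t where "exp (- x) = (\<Sum>m<3. (- x) ^ m / fact m) + exp t / fact 3 * (- x) ^ 3" by blast
  moreover have "exp t / fact 3 * (- x) ^ 3 \<le> 0" using assms by (simp add: zero_le_mult_iff)
  ultimately show "exp (- x) \<le> 1 - x + x\<^sup>2 / 2" by (simp add: numeral_eq_Suc)
qed

lemma geometric_le_power:
  fixes \<rho> s :: real assumes "0 < \<rho>" "\<rho> < 1"
  obtains C where "C \<ge> 0" "\<And>N. N > 0 \<Longrightarrow> \<rho> ^ N \<le> C * (real N powr (- s) / real N)"
proof -
  have "(\<lambda>N. real N powr (s + 1) * \<rho> ^ N) \<longlonglongrightarrow> 0"
    using assms by real_asymp
  then have "Bseq (\<lambda>N. real N powr (s + 1) * \<rho> ^ N)" by (intro convergent_imp_Bseq convergentI)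
  then obtain C where C: "C > 0" "\<And>N. norm (real N powr (s + 1) * \<rho> ^ N) \<le> C" by (auto elim: BseqE)
  show ?thesis
  proof (rule that[of C])
    fix N :: nat assume N: "N > 0"
    have "real N powr (s + 1) * \<rho> ^ N \<le> C" using C(2)[of N] assms by (simp add: abs_mult)
    then have "\<rho> ^ N \<le> C / real N powr (s + 1)" using N by (simp add: pos_le_divide_eq mult.commute)
    also have "\<dots> = C * (real N powr (- s) / real N)"
      using N by (simp add: powr_add powr_minus field_simps)
    finally show "\<rho> ^ N \<le> C * (real N powr (- s) / real N)" .
  qed (use C in simp)
qed

lemma asymptotic_equivalence_from_error:
  fixes p :: "nat \<Rightarrow> real"
  assumes K: "K > 0" and err: "\<And>N. N > 0 \<Longrightarrow> \<bar>p N - K * (2 * pi * real N) powr (- s)\<bar> \<le> C * (real N powr (- s) / real N)"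
  shows "\<exists>\<epsilon> \<in> O(\<lambda>N. 1 / real N). \<forall>\<^sub>F N in sequentially. p N = K * (2 * pi * real N) powr (- s) * (1 + \<epsilon> N)"
proof -
  define I where "I = (\<lambda>N. K * (2 * pi * real N) powr (- s))"
  have I: "I N > 0" if "N > 0" for N using that K by (simp add: I_def)
  define \<epsilon> where "\<epsilon> = (\<lambda>N. p N / I N - 1)"
  have "\<bar>\<epsilon> N\<bar> \<le> C / (K * (2 * pi) powr (- s)) * \<bar>1 / real N\<bar>" if N: "N > 0" for N
  proof -
    have "\<bar>\<epsilon> N\<bar> = \<bar>p N - I N\<bar> / I N"
      using I[OF N] by (simp add: \<epsilon>_def abs_divide field_simps)
    also have "\<dots> \<le> C * (real N powr (- s) / real N) / I N"
      using err[OF N] I[OF N] by (intro divide_right_mono) (auto simp: I_def)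
    also have "\<dots> = C / (K * (2 * pi) powr (- s)) * \<bar>1 / real N\<bar>"
      using N by (simp add: I_def powr_mult)
    finally show ?thesis .
  qed
  then have "\<epsilon> \<in> O(\<lambda>N. 1 / real N)"
    by (intro bigoI[of _ "C / (K * (2 * pi) powr (- s))"]) (auto intro: eventually_mono[OF eventually_gt_at_top[of 0]])
  moreover have "\<forall>\<^sub>F N in sequentially. p N = I N * (1 + \<epsilon> N)"
    using eventually_gt_at_top[of 0]
  proof eventually_elim
    case (elim N)
    then show ?case using I[of N] by (simp add: \<epsilon>_def)
  qed
  ultimately show ?thesis unfolding I_def by blast
qed

section \<open>Centred lattice walks and their characteristic functions\<close>

lemma abs_lt_1_int_0: "x \<in> \<int> \<Longrightarrow> \<bar>x\<bar> < (1 :: real) \<Longrightarrow> x = 0"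
  by (auto elim!: Ints_cases)

lemma det_in_Ints:
  fixes M :: "real^'n^'n"
  assumes "\<And>i j. M $ i $ j \<in> \<int>"
  shows "det M \<in> \<int>"
  unfolding det_def using assms by (intro Ints_sum Ints_mult Ints_prod Ints_of_int) auto

text \<open>Strict convexity of the unit disc, in the form used for characteristic functions: a convex
combination of unit vectors has length 1 only if they all agree.\<close>

lemma norm_convex_unit_less_1:
  fixes z :: "'b \<Rightarrow> complex"
  assumes S: "finite S" "\<And>b. b \<in> S \<Longrightarrow> w b > 0" "sum w S = 1"
    and z: "\<And>b. b \<in> S \<Longrightarrow> norm (z b) = 1"
    and a: "a \<in> S" "z a = 1" and b: "b \<in> S" "z b \<noteq> 1"
  shows "norm (\<Sum>b\<in>S. of_real (w b) * z b) < 1"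
proof -
  have ab: "a \<noteq> b" using a b by auto
  let ?R = "S - {a, b}"
  have split: "sum f S = f a + f b + sum f ?R" for f :: "'b \<Rightarrow> 'c::comm_monoid_add"
  proof -
    have "sum f S = sum f {a, b} + sum f ?R"
      using S(1) a b by (subst sum.subset_diff[of "{a,b}"]) (auto simp: add.commute)
    then show ?thesis using ab by simp
  qed
  have w: "w a > 0" "w b > 0" using S a b by auto
  have "norm (of_real (w a) * z a + of_real (w b) * z b) < w a + w b"
  proof -
    have n: "(Re (z b))\<^sup>2 + (Im (z b))\<^sup>2 = 1" using z[OF b(1)] by (simp flip: cmod_power2)
    have "Re (z b) < 1"
    proof (rule ccontr)
      assume "\<not> Re (z b) < 1"
      then have "Re (z b) = 1" using z[OF b(1)] complex_Re_le_cmod[of "z b"] by simp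
      with n have "z b = 1" by (simp add: complex_eq_iff)
      with b show False by simp
    qed
    then have "w a * w b * Re (z b) < w a * w b * 1" using w by (intro mult_strict_left_mono) auto
    moreover have "(norm (of_real (w a) * z a + of_real (w b) * z b))\<^sup>2
        = (w a)\<^sup>2 + 2 * (w a * w b * Re (z b)) + (w b)\<^sup>2 * ((Re (z b))\<^sup>2 + (Im (z b))\<^sup>2)"
      unfolding cmod_power2 using a(2) by (simp add: power2_sum power_mult_distrib distrib_left)
    ultimately have "(norm (of_real (w a) * z a + of_real (w b) * z b))\<^sup>2 < (w a + w b)\<^sup>2"
      unfolding n power2_sum by linarith
    then show ?thesis using w by (simp add: power2_less_imp_less)
  qed
  moreover have "norm (\<Sum>b\<in>?R. of_real (w b) * z b) \<le> sum w ?R"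
    using S z by (intro order_trans[OF norm_sum] sum_mono) (auto simp: norm_mult intro: less_imp_le)
  moreover have "sum w S = w a + w b + sum w ?R" by (rule split)
  ultimately show ?thesis
    unfolding split[of "\<lambda>b. of_real (w b) * z b"]
    using norm_triangle_ineq[of "of_real (w a) * z a + of_real (w b) * z b" "\<Sum>b\<in>?R. of_real (w b) * z b"] S(3)
    by linarith
qed

text \<open>A centred random walk on \<open>\<int>\<^sup>n\<close> with finitely many steps \<open>v b\<close>, taken with probabilities \<open>w b\<close>. That
one of the steps is 0 makes the walk aperiodic: it forces the characteristic function to be 1 wherever
its modulus is 1.\<close>

locale lattice_walk =
  fixes S :: "'b set" and w :: "'b \<Rightarrow> real" and v :: "'b \<Rightarrow> real^'n::{finite,wellorder}" and b0 :: 'b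
  assumes finite_S: "finite S"
    and w_pos: "\<And>b. b \<in> S \<Longrightarrow> w b > 0"
    and sum_w: "sum w S = 1"
    and mean_zero: "(\<Sum>b\<in>S. w b *\<^sub>R v b) = 0"
    and b0: "b0 \<in> S" "v b0 = 0"
    and v_int: "\<And>b i. b \<in> S \<Longrightarrow> v b $ i \<in> \<int>"
    and nondegenerate: "\<And>t. (\<And>b. b \<in> S \<Longrightarrow> v b \<bullet> t = 0) \<Longrightarrow> t = 0"
begin

lemma w_nonneg: "b \<in> S \<Longrightarrow> w b \<ge> 0"
  using w_pos less_imp_le by blast

definition charfun :: "(real, 'n) vec \<Rightarrow> complex"
  where "charfun t = (\<Sum>b\<in>S. of_real (w b) * circle_exp (v b \<bullet> t))"

definition periods :: "((real, 'n) vec) set"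
  where "periods = {t. \<forall>b\<in>S. v b \<bullet> t \<in> \<int>}"

definition cov :: "((real, 'n) vec, 'n) vec"
  where "cov = (\<chi> i j. \<Sum>b\<in>S. w b * v b $ i * v b $ j)"

definition gauss :: "(real, 'n) vec \<Rightarrow> real"
  where "gauss t = exp (- (2 * pi\<^sup>2) * (t \<bullet> (cov *v t)))"

definition walk_prob :: "nat \<Rightarrow> (real, 'n) vec \<Rightarrow> real"
  where "walk_prob N g =
    (\<Sum>bs\<in>{bs. set bs \<subseteq> S \<and> length bs = N \<and> sum_list (map v bs) = g}. prod_list (map w bs))"

lemma inner_cov: "t \<bullet> (cov *v t) = (\<Sum>b\<in>S. w b * (v b \<bullet> t)\<^sup>2)"
proof -
  have "cov *v t = (\<Sum>b\<in>S. (w b * (v b \<bullet> t)) *\<^sub>R v b)"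
    by (auto simp: vec_eq_iff matrix_vector_mult_def cov_def inner_vec_def sum_distrib_left
          sum_distrib_right mult_ac intro: sum.swap)
  then show ?thesis
    by (simp add: inner_sum_right inner_commute[of t] power2_eq_square mult_ac)
qed

lemma cov_nonneg: "t \<bullet> (cov *v t) \<ge> 0"
  unfolding inner_cov using w_nonneg by (intro sum_nonneg) auto

lemma cov_pos: assumes "t \<noteq> 0" shows "t \<bullet> (cov *v t) > 0"
proof -
  obtain b where b: "b \<in> S" "v b \<bullet> t \<noteq> 0" using nondegenerate[of t] assms by blast
  have "0 < w b * (v b \<bullet> t)\<^sup>2" using b w_pos by auto
  also have "\<dots> \<le> (\<Sum>b\<in>S. w b * (v b \<bullet> t)\<^sup>2)"
    using b w_nonneg finite_S by (intro member_le_sum) auto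
  finally show ?thesis by (simp add: inner_cov)
qed

lemma cov_sym: "transpose cov = cov"
  by (simp add: transpose_def cov_def vec_eq_iff mult_ac)

lemma cov_coercive: obtains \<mu> where "\<mu> > 0" "\<And>t. \<mu> * (norm t)\<^sup>2 \<le> t \<bullet> (cov *v t)"
proof -
  let ?f = "\<lambda>t. t \<bullet> (cov *v t)"
  let ?x = "axis undefined 1 :: (real, 'n) vec"
  have "?x \<in> sphere 0 1" by simp
  then have ne: "sphere (0 :: (real, 'n) vec) 1 \<noteq> {}" by blast
  have "continuous_on (sphere 0 1) ?f"
    by (intro continuous_intros linear_continuous_on) (simp add: linear_linear[symmetric])
  then obtain x where x: "x \<in> sphere 0 1" "\<And>y. y \<in> sphere 0 1 \<Longrightarrow> ?f x \<le> ?f y"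
    using continuous_attains_inf[OF compact_sphere ne] by blast
  have "x \<noteq> 0" using x(1) by auto
  show ?thesis
  proof (rule that[of "?f x"])
    show "?f x > 0" by (rule cov_pos) fact
    show "?f x * (norm t)\<^sup>2 \<le> ?f t" for t
    proof (cases "t = 0")
      case False
      have "?f x \<le> ?f ((1 / norm t) *\<^sub>R t)" using False by (intro x(2)) simp
      also have "\<dots> = ?f t / (norm t)\<^sup>2"
        unfolding inner_cov by (simp add: power_divide sum_divide_distrib)
      finally show ?thesis using False by (simp add: field_simps)
    qed simp
  qed
qed

text \<open>Choose a basis of \<open>\<real>\<^sup>n\<close> among the steps. A period solves a linear system whose matrix consists of these
integer vectors and whose right-hand side is integral, so by Cramer's rule the determinant is a common
denominator.\<close>

lemma periods_denominator: obtains q :: nat where "q > 0" "\<And>y i. y \<in> periods \<Longrightarrow> real q * y $ i \<in> \<int>"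
proof -
  have spanV: "span (v ` S) = UNIV"
  proof (rule ccontr)
    assume "span (v ` S) \<noteq> UNIV"
    then obtain a where "a \<noteq> 0" "\<forall>x\<in>span (v ` S). a \<bullet> x = 0"
      using span_not_UNIV_orthogonal by blast
    then show False using nondegenerate[of a] by (auto simp: inner_commute span_base)
  qed
  obtain B where B: "B \<subseteq> v ` S" "independent B" "v ` S \<subseteq> span B"
    using maximal_independent_subset[of "v ` S"] by blast
  have spanB: "span B = UNIV" using spanV B(3) span_minimal[OF B(3) subspace_span] by auto
  have "card B = CARD('n)"
    using dim_eq_card[of B "UNIV :: ((real, 'n) vec) set"] spanB B(2) by simp
  then obtain u where u: "bij_betw u (UNIV :: 'n set) B"
    using finite_same_card_bij[of "UNIV :: 'n set" B] finite_subset[OF B(1)] finite_S by auto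
  have uB: "u i \<in> B" for i using u by (auto simp: bij_betw_def)
  define M where "M = (\<chi> i j. u i $ j)"
  have Mt: "(M *v t) $ i = u i \<bullet> t" for t i
    by (simp add: M_def matrix_vector_mult_def inner_vec_def)
  have "inj ((*v) M)"
  proof (rule linear_injective_0[THEN iffD2, rule_format])
    show "linear ((*v) M)" by simp
    fix t assume "M *v t = 0"
    then have "u i \<bullet> t = 0" for i by (simp flip: Mt)
    then have "\<forall>x\<in>B. t \<bullet> x = 0" using u by (auto simp: bij_betw_def inner_commute)
    then have "t \<bullet> t = 0"
      using spanB orthogonal_to_span[of t B t] unfolding orthogonal_def by auto
    then show "t = 0" by simp
  qed
  then have "invertible M"
    by (simp add: invertible_left_inverse matrix_left_invertible_injective)
  then have d0: "det M \<noteq> 0" by (simp add: invertible_det_nz)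
  have Mi: "M $ i $ j \<in> \<int>" for i j
    using uB[of i] B(1) v_int by (auto simp: M_def)
  obtain d where d: "det M = of_int d" using det_in_Ints[of M] Mi by (auto elim: Ints_cases)
  show ?thesis
  proof (rule that[of "nat \<bar>d\<bar>"])
    show "nat \<bar>d\<bar> > 0" using d d0 by simp
    fix y i assume y: "y \<in> periods"
    have My: "(M *v y) $ j \<in> \<int>" for j
      using uB[of j] B(1) y by (auto simp: Mt periods_def)
    have "y = (\<chi> k. det (\<chi> i j. if j = k then (M *v y) $ i else M $ i $ j) / det M)"
      using cramer[OF d0, of y "M *v y"] by simp
    then have "y $ i = det (\<chi> i' j. if j = i then (M *v y) $ i' else M $ i' $ j) / det M"
      by (metis (no_types, lifting) vec_lambda_beta)
    moreover have "det (\<chi> i' j. if j = i then (M *v y) $ i' else M $ i' $ j) \<in> \<int>"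
      using My Mi by (intro det_in_Ints) auto
    ultimately have "of_int d * y $ i \<in> \<int>" using d d0 by simp
    then show "real (nat \<bar>d\<bar>) * y $ i \<in> \<int>"
      by (cases "d \<ge> 0") (auto simp: abs_if)
  qed
qed

lemma charfun_add_period: assumes "y \<in> periods" shows "charfun (t + y) = charfun t"
  unfolding charfun_def using assms
  by (intro sum.cong) (auto simp: inner_add_right circle_exp_add circle_exp_int periods_def)

lemma norm_charfun_less_1: assumes "t \<notin> periods" shows "norm (charfun t) < 1"
proof -
  obtain b where b: "b \<in> S" "v b \<bullet> t \<notin> \<int>" using assms by (auto simp: periods_def)
  show ?thesis
    unfolding charfun_def
    by (rule norm_convex_unit_less_1[OF finite_S w_pos sum_w _ b0(1) _ b(1)])
       (use b b0 in \<open>auto simp: circle_exp_eq_1_iff\<close>)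
qed

lemma continuous_on_charfun: "continuous_on X f \<Longrightarrow> continuous_on X (\<lambda>t. charfun (f t))"
  unfolding charfun_def by (intro continuous_intros continuous_on_circle_exp)

text \<open>The real part is the sum of cosines, which agrees with the Gaussian up to fourth order. The imaginary
part is the sum of sines, whose linear term vanishes because the walk is centred.\<close>

lemma charfun_taylor:
  obtains D where "D \<ge> 0" "\<And>t. \<bar>Re (charfun t) - gauss t\<bar> \<le> D * norm t ^ 4"
    "\<And>t. \<bar>Im (charfun t)\<bar> \<le> D * norm t ^ 3"
proof -
  define D1 where "D1 = (\<Sum>b\<in>S. w b * ((2 * pi * norm (v b)) ^ 4 / 24))"
  define D2 where "D2 = (\<Sum>b\<in>S. w b * ((2 * pi * norm (v b)) ^ 3 / 6))"
  define D3 where "D3 = (\<Sum>b\<in>S. w b * (norm (v b))\<^sup>2)"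
  define D4 where "D4 = (2 * pi\<^sup>2 * D3)\<^sup>2 / 2"
  have pos: "D1 \<ge> 0" "D2 \<ge> 0" "D4 \<ge> 0"
    using w_nonneg unfolding D1_def D2_def D4_def by (auto intro!: sum_nonneg)
  have y: "\<bar>2 * pi * (v b \<bullet> t)\<bar> \<le> 2 * pi * norm (v b) * norm t" for b t
    using Cauchy_Schwarz_ineq2[of "v b" t] by (simp add: abs_mult mult_left_mono)
  have "\<bar>Re (charfun t) - gauss t\<bar> \<le> (D1 + D2 + D4) * norm t ^ 4" for t
  proof -
    let ?Q = "2 * pi\<^sup>2 * (t \<bullet> (cov *v t))"
    have Q: "?Q = (\<Sum>b\<in>S. w b * ((2 * pi * (v b \<bullet> t))\<^sup>2 / 2))"
      unfolding inner_cov sum_distrib_left by (intro sum.cong) (auto simp: power_mult_distrib)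
    have "Re (charfun t) - (1 - ?Q) = (\<Sum>b\<in>S. w b * (cos (2 * pi * (v b \<bullet> t)) - (1 - (2 * pi * (v b \<bullet> t))\<^sup>2 / 2)))"
      unfolding Q right_diff_distrib sum_subtractf using sum_w by (simp add: charfun_def circle_exp_def)
    also have "\<bar>\<dots>\<bar> \<le> (\<Sum>b\<in>S. w b * ((2 * pi * norm (v b) * norm t) ^ 4 / 24))"
    proof (intro order_trans[OF sum_abs] sum_mono)
      fix b assume b: "b \<in> S"
      have "\<bar>cos (2 * pi * (v b \<bullet> t)) - (1 - (2 * pi * (v b \<bullet> t))\<^sup>2 / 2)\<bar>
          \<le> (2 * pi * norm (v b) * norm t) ^ 4 / 24"
        using y[of b t] by (intro order_trans[OF cos_quadratic_bound] divide_right_mono power_mono) auto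
      then show "\<bar>w b * (cos (2 * pi * (v b \<bullet> t)) - (1 - (2 * pi * (v b \<bullet> t))\<^sup>2 / 2))\<bar>
          \<le> w b * ((2 * pi * norm (v b) * norm t) ^ 4 / 24)"
        using w_pos[OF b] unfolding abs_mult by (intro mult_mono) auto
    qed
    also have "\<dots> = D1 * norm t ^ 4"
      unfolding D1_def sum_distrib_right by (intro sum.cong) (simp_all add: power_mult_distrib)
    finally have 1: "\<bar>Re (charfun t) - (1 - ?Q)\<bar> \<le> D1 * norm t ^ 4" .
    have Q0: "?Q \<ge> 0" using cov_nonneg by simp
    have "t \<bullet> (cov *v t) \<le> D3 * (norm t)\<^sup>2"
      unfolding inner_cov D3_def sum_distrib_right
    proof (intro sum_mono)
      fix b assume b: "b \<in> S"
      have "(v b \<bullet> t)\<^sup>2 \<le> (norm (v b) * norm t)\<^sup>2"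
        using Cauchy_Schwarz_ineq2[of "v b" t] by (simp add: abs_le_square_iff[symmetric])
      then show "w b * (v b \<bullet> t)\<^sup>2 \<le> w b * (norm (v b))\<^sup>2 * (norm t)\<^sup>2"
        using w_pos[OF b] by (simp add: power_mult_distrib)
    qed
    then have "?Q \<le> 2 * pi\<^sup>2 * D3 * (norm t)\<^sup>2"
      by (metis mult.assoc mult_left_mono zero_le_power2 zero_le_numeral mult_nonneg_nonneg)
    then have "?Q\<^sup>2 / 2 \<le> (2 * pi\<^sup>2 * D3 * (norm t)\<^sup>2)\<^sup>2 / 2"
      using Q0 by (intro divide_right_mono power_mono) auto
    also have "\<dots> = D4 * norm t ^ 4"
      by (simp add: D4_def power_mult_distrib flip: power_mult)
    finally have "\<bar>gauss t - (1 - ?Q)\<bar> \<le> D4 * norm t ^ 4"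
      using exp_minus_bounds[OF Q0] by (simp add: gauss_def)
    moreover have "D2 * norm t ^ 4 \<ge> 0" using pos by simp
    ultimately show ?thesis using 1 unfolding distrib_right by linarith
  qed
  moreover have "\<bar>Im (charfun t)\<bar> \<le> (D1 + D2 + D4) * norm t ^ 3" for t
  proof -
    have "(\<Sum>b\<in>S. w b * (v b \<bullet> t)) = (\<Sum>b\<in>S. w b *\<^sub>R v b) \<bullet> t" by (simp add: inner_sum_left)
    then have "(\<Sum>b\<in>S. w b * (v b \<bullet> t)) = 0" by (simp add: mean_zero)
    moreover have "(\<Sum>b\<in>S. w b * (2 * pi * (v b \<bullet> t))) = 2 * pi * (\<Sum>b\<in>S. w b * (v b \<bullet> t))"
      unfolding sum_distrib_left by (intro sum.cong) auto
    ultimately have z: "(\<Sum>b\<in>S. w b * (2 * pi * (v b \<bullet> t))) = 0" by simp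
    have "Im (charfun t) = (\<Sum>b\<in>S. w b * (sin (2 * pi * (v b \<bullet> t)) - 2 * pi * (v b \<bullet> t)))"
      using z unfolding right_diff_distrib sum_subtractf by (simp add: charfun_def circle_exp_def)
    also have "\<bar>\<dots>\<bar> \<le> (\<Sum>b\<in>S. w b * ((2 * pi * norm (v b) * norm t) ^ 3 / 6))"
    proof (intro order_trans[OF sum_abs] sum_mono)
      fix b assume b: "b \<in> S"
      have "\<bar>sin (2 * pi * (v b \<bullet> t)) - 2 * pi * (v b \<bullet> t)\<bar> \<le> (2 * pi * norm (v b) * norm t) ^ 3 / 6"
        using y[of b t] by (intro order_trans[OF sin_linear_bound] divide_right_mono power_mono) auto
      then show "\<bar>w b * (sin (2 * pi * (v b \<bullet> t)) - 2 * pi * (v b \<bullet> t))\<bar>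
          \<le> w b * ((2 * pi * norm (v b) * norm t) ^ 3 / 6)"
        using w_pos[OF b] unfolding abs_mult by (intro mult_mono) auto
    qed
    also have "\<dots> = D2 * norm t ^ 3"
      unfolding D2_def sum_distrib_right by (intro sum.cong) (simp_all add: power_mult_distrib)
    also have "\<dots> \<le> (D1 + D2 + D4) * norm t ^ 3"
      using pos by (intro mult_right_mono) auto
    finally show ?thesis .
  qed
  ultimately show ?thesis using that[of "D1 + D2 + D4"] pos by auto
qed

lemma walk_prob_generating:
  "charfun t ^ N = (\<Sum>bs\<in>{bs. set bs \<subseteq> S \<and> length bs = N}.
      of_real (prod_list (map w bs)) * circle_exp (sum_list (map v bs) \<bullet> t))"
proof (induction N)
  case 0
  have "{bs. set bs \<subseteq> S \<and> length bs = 0} = {[]}" by auto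
  then show ?case by simp
next
  case (Suc N)
  let ?T = "{bs. set bs \<subseteq> S \<and> length bs = N}"
  have "(\<Sum>bs\<in>{bs. set bs \<subseteq> S \<and> length bs = Suc N}. of_real (prod_list (map w bs)) * circle_exp (sum_list (map v bs) \<bullet> t))
      = (\<Sum>(bs, b)\<in>?T \<times> S. of_real (prod_list (map w (b # bs))) * circle_exp (sum_list (map v (b # bs)) \<bullet> t))"
    unfolding lists_length_Suc_eq by (subst sum.reindex) (auto simp: inj_on_def case_prod_unfold)
  also have "\<dots> = (\<Sum>bs\<in>?T. of_real (prod_list (map w bs)) * circle_exp (sum_list (map v bs) \<bullet> t)) *
      (\<Sum>b\<in>S. of_real (w b) * circle_exp (v b \<bullet> t))"
    unfolding sum_product sum.cartesian_product
    by (intro sum.cong) (auto simp: inner_add_left circle_exp_add mult_ac)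
  finally show ?case unfolding power_Suc2 Suc.IH by (simp only: charfun_def)
qed

text \<open>Fourier inversion. The generating function \<open>charfun t ^ N\<close> is expanded over all paths, and
\<open>orthogonality_shifted_cubes\<close> picks out the paths that end at \<open>g\<close>.\<close>

lemma walk_prob_fourier:
  assumes q: "q > 0" and g: "\<And>i. g $ i \<in> \<int>"
  shows "has_bochner_integral lborel
    (\<lambda>t. indicator (cube q) t * (\<Sum>k\<in>grid q. Re (circle_exp (- (g \<bullet> (t + k))) * charfun (t + k) ^ N))) (walk_prob N g)"
proof -
  let ?T = "{bs. set bs \<subseteq> S \<and> length bs = N}"
  have finT: "finite ?T" using finite_lists_length_eq[OF finite_S] by simp
  have vi: "sum_list (map v bs) $ i \<in> \<int>" if "set bs \<subseteq> S" for bs i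
    using that v_int by (induction bs) auto
  have "has_bochner_integral lborel
      (\<lambda>t. \<Sum>bs\<in>?T. of_real (prod_list (map w bs)) *
         (indicator (cube q) t *\<^sub>R (\<Sum>k\<in>grid q. circle_exp ((sum_list (map v bs) - g) \<bullet> (t + k)))))
      (\<Sum>bs\<in>?T. of_real (prod_list (map w bs)) * (if sum_list (map v bs) - g = 0 then 1 else 0))"
    using g vi by (intro has_bochner_integral_sum has_bochner_integral_mult_right
      orthogonality_shifted_cubes q) auto
  also have "(\<Sum>bs\<in>?T. of_real (prod_list (map w bs)) * (if sum_list (map v bs) - g = 0 then 1 else 0))
      = (of_real (walk_prob N g) :: complex)"
  proof -
    have "(\<Sum>bs\<in>?T. of_real (prod_list (map w bs)) * (if sum_list (map v bs) - g = 0 then 1 else 0))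
        = (\<Sum>bs\<in>?T. if sum_list (map v bs) = g then of_real (prod_list (map w bs)) else (0 :: complex))"
      by (intro sum.cong) auto
    also have "\<dots> = (\<Sum>bs\<in>{bs \<in> ?T. sum_list (map v bs) = g}. of_real (prod_list (map w bs)))"
      by (rule sum.inter_filter[OF finT, symmetric])
    also have "{bs \<in> ?T. sum_list (map v bs) = g} = {bs. set bs \<subseteq> S \<and> length bs = N \<and> sum_list (map v bs) = g}"
      by auto
    finally show ?thesis by (simp add: walk_prob_def)
  qed
  also have "(\<lambda>t. \<Sum>bs\<in>?T. of_real (prod_list (map w bs)) *
         (indicator (cube q) t *\<^sub>R (\<Sum>k\<in>grid q. circle_exp ((sum_list (map v bs) - g) \<bullet> (t + k)))))
     = (\<lambda>t. indicator (cube q) t *\<^sub>R (\<Sum>k\<in>grid q. circle_exp (- (g \<bullet> (t + k))) * charfun (t + k) ^ N))"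
  proof
    fix t
    have e: "circle_exp ((x - g) \<bullet> y) = circle_exp (- (g \<bullet> y)) * circle_exp (x \<bullet> y)" for x y
      by (simp add: inner_diff_left flip: circle_exp_add)
    show "(\<Sum>bs\<in>?T. of_real (prod_list (map w bs)) *
         (indicator (cube q) t *\<^sub>R (\<Sum>k\<in>grid q. circle_exp ((sum_list (map v bs) - g) \<bullet> (t + k)))))
      = indicator (cube q) t *\<^sub>R (\<Sum>k\<in>grid q. circle_exp (- (g \<bullet> (t + k))) * charfun (t + k) ^ N)"
      unfolding walk_prob_generating e sum_distrib_left scaleR_sum_right
      by (subst sum.swap) (intro sum.cong, auto simp: mult_ac)
  qed
  finally have "has_bochner_integral lborel
     (\<lambda>t. Re (indicator (cube q) t *\<^sub>R (\<Sum>k\<in>grid q. circle_exp (- (g \<bullet> (t + k))) * charfun (t + k) ^ N)))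
     (Re (of_real (walk_prob N g)))"
    by (rule has_bochner_integral_bounded_linear[OF bounded_linear_Re])
  then show ?thesis by simp
qed

section \<open>The local limit theorem\<close>

lemma cube_period_zero:
  assumes q: "q > 0" "\<And>y i. y \<in> periods \<Longrightarrow> real q * y $ i \<in> \<int>"
    and t: "t \<in> cube q" and k: "k \<in> grid q" and tk: "t + k \<in> periods"
  shows "t = 0"
proof -
  have "real q * t $ i = 0" for i
  proof (rule abs_lt_1_int_0)
    obtain j where j: "k $ i = real j / real q" using k by (auto simp: grid_def)
    have "real q * (t + k) $ i - real j \<in> \<int>" using q(2)[OF tk] by (intro Ints_diff) auto
    then show "real q * t $ i \<in> \<int>" using q(1) j by (simp add: distrib_left)
    have "\<bar>t $ i\<bar> \<le> 1 / (2 * real q)"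
      using t by (auto simp: cube_def mem_box_cart abs_le_iff minus_le_iff)
    then have "real q * \<bar>t $ i\<bar> \<le> 1 / 2" using q(1) by (simp add: field_simps)
    then show "\<bar>real q * t $ i\<bar> < 1" by (simp add: abs_mult)
  qed
  then show "t = 0" using q(1) by (auto simp: vec_eq_iff)
qed

lemma gauss_power: "gauss t ^ N = exp (- (2 * pi\<^sup>2 * real N) * (t \<bullet> (cov *v t)))"
  by (simp add: gauss_def mult_ac flip: exp_of_nat_mult)

lemma gauss_decay:
  obtains \<mu> where "\<mu> > 0" "\<And>t. gauss t \<le> exp (- \<mu> * (norm t)\<^sup>2)"
proof -
  obtain \<mu> where \<mu>: "\<mu> > 0" "\<And>t. \<mu> * (norm t)\<^sup>2 \<le> t \<bullet> (cov *v t)" by (rule cov_coercive) blast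
  show ?thesis
  proof (rule that[of "2 * pi\<^sup>2 * \<mu>"])
    show "gauss t \<le> exp (- (2 * pi\<^sup>2 * \<mu>) * (norm t)\<^sup>2)" for t
      using mult_left_mono[OF \<mu>(2)[of t], of "2 * pi\<^sup>2"] by (simp add: gauss_def mult_ac)
  qed (use \<mu> in simp)
qed

text \<open>Near 0 the quadratic term of the Taylor expansion dominates. On the rest of the cube there are no
periods, so the modulus is bounded away from 1 by compactness, and a Gaussian that is wide enough
stays above that bound.\<close>

lemma charfun_decay:
  assumes q: "q > 0" "\<And>y i. y \<in> periods \<Longrightarrow> real q * y $ i \<in> \<int>"
  obtains c where "c > 0" "\<And>t. t \<in> cube q \<Longrightarrow> norm (charfun t) \<le> exp (- c * (norm t)\<^sup>2)"
    "\<And>t. gauss t \<le> exp (- c * (norm t)\<^sup>2)"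
proof -
  obtain \<mu> where \<mu>: "\<mu> > 0" "\<And>t. gauss t \<le> exp (- \<mu> * (norm t)\<^sup>2)" by (rule gauss_decay) blast
  obtain D where D: "D \<ge> 0" "\<And>t. \<bar>Re (charfun t) - gauss t\<bar> \<le> D * norm t ^ 4"
    "\<And>t. \<bar>Im (charfun t)\<bar> \<le> D * norm t ^ 3" by (rule charfun_taylor) blast
  \<comment> \<open>radius below which the cubic and quartic terms take at most half of the quadratic one\<close>
  define H where "H = \<mu>\<^sup>2 / 2 + 2 * D + 1"
  define r0 where "r0 = min 1 ((\<mu> / 2) / H)"
  have H: "H > 0" using D by (auto simp: H_def add_nonneg_pos)
  have r0: "r0 > 0" "r0 \<le> 1" using \<mu> H by (auto simp: r0_def)
  have near: "norm (charfun t) \<le> exp (- (\<mu> / 2) * (norm t)\<^sup>2)" if t: "norm t \<le> r0" for t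
  proof -
    define r where "r = norm t"
    have r: "0 \<le> r" "r \<le> r0" "r \<le> 1" using t r0 by (auto simp: r_def)
    have "gauss t \<le> 1 - \<mu> * r\<^sup>2 + (\<mu> * r\<^sup>2)\<^sup>2 / 2"
      using \<mu>(2)[of t] exp_minus_bounds(2)[of "\<mu> * r\<^sup>2"] \<mu>(1) by (simp add: r_def)
    moreover have "norm (charfun t) \<le> \<bar>Re (charfun t)\<bar> + \<bar>Im (charfun t)\<bar>" by (rule cmod_le)
    moreover have "gauss t \<ge> 0" by (simp add: gauss_def)
    ultimately have "norm (charfun t) \<le> 1 - \<mu> * r\<^sup>2 + (\<mu> * r\<^sup>2)\<^sup>2 / 2 + D * r ^ 4 + D * r ^ 3"
      using D(2,3)[of t] unfolding r_def by linarith
    moreover have "(\<mu> * r\<^sup>2)\<^sup>2 / 2 + D * r ^ 4 + D * r ^ 3 = r\<^sup>2 * (r * (\<mu>\<^sup>2 / 2 * r + D * r + D))"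
      by (simp add: field_simps numeral_eq_Suc)
    moreover have "r\<^sup>2 * (r * (\<mu>\<^sup>2 / 2 * r + D * r + D)) \<le> r\<^sup>2 * (\<mu> / 2)"
    proof (intro mult_left_mono)
      have "r * (\<mu>\<^sup>2 / 2 * r + D * r + D) \<le> r0 * H"
      proof (intro mult_mono)
        have "\<mu>\<^sup>2 / 2 * r \<le> \<mu>\<^sup>2 / 2" "D * r \<le> D"
          using r D(1) by (auto intro: mult_left_le mult_right_le_one_le)
        then show "\<mu>\<^sup>2 / 2 * r + D * r + D \<le> H" by (simp add: H_def)
      qed (use r r0 D in auto)
      also have "r0 * H \<le> \<mu> / 2"
      proof -
        have "r0 \<le> (\<mu> / 2) / H" by (simp add: r0_def)
        then show ?thesis using H by (simp add: pos_le_divide_eq)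
      qed
      finally show "r * (\<mu>\<^sup>2 / 2 * r + D * r + D) \<le> \<mu> / 2" .
    qed simp
    moreover have "r\<^sup>2 * (\<mu> / 2) = (\<mu> / 2) * r\<^sup>2" "\<mu> * r\<^sup>2 = (\<mu> / 2) * r\<^sup>2 + (\<mu> / 2) * r\<^sup>2"
      by simp_all
    ultimately have "norm (charfun t) \<le> 1 - (\<mu> / 2) * r\<^sup>2" by linarith
    also have "\<dots> \<le> exp (- ((\<mu> / 2) * r\<^sup>2))" using \<mu>(1) by (intro exp_minus_bounds(1)) simp
    finally show ?thesis by (simp add: r_def)
  qed
  define K where "K = cube q \<inter> {t :: (real, 'n) vec. r0 \<le> norm t}"
  have "compact K"
    unfolding K_def cube_def by (intro compact_Int_closed compact_cbox closed_Collect_le continuous_intros)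
  moreover have "continuous_on K (\<lambda>t. norm (charfun t))"
    by (intro continuous_intros continuous_on_charfun)
  moreover have "norm (charfun t) < 1" if "t \<in> K" for t
  proof (rule norm_charfun_less_1, rule notI)
    assume "t \<in> periods"
    with cube_period_zero[OF q, of t 0] that zero_in_grid[OF q(1)] have "t = 0" by (simp add: K_def)
    with that r0 show False by (simp add: K_def)
  qed
  ultimately obtain s where s: "0 < s" "s < 1" "\<And>t. t \<in> K \<Longrightarrow> norm (charfun t) \<le> s"
    using compact_bound_below_1[of K "\<lambda>t. norm (charfun t)"] by blast
  obtain R where R: "R > 0" "\<And>t. t \<in> (cube q :: (real, 'n) vec set) \<Longrightarrow> norm t \<le> R"
    using bounded_cbox bounded_pos unfolding cube_def by metis
  \<comment> \<open>the second bound makes \<open>exp (- c r\<^sup>2) \<ge> s\<close> for all \<open>r \<le> R\<close>\<close>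
  define c where "c = min (\<mu> / 2) (- ln s / R\<^sup>2)"
  have c: "c > 0" "c \<le> \<mu> / 2" "c * R\<^sup>2 \<le> - ln s"
    using \<mu> s R(1) by (auto simp: c_def min_def field_simps)
  show ?thesis
  proof (rule that[OF c(1)])
    fix t :: "(real, 'n) vec" assume t: "t \<in> cube q"
    show "norm (charfun t) \<le> exp (- c * (norm t)\<^sup>2)"
    proof (cases "norm t \<le> r0")
      case True
      have "norm (charfun t) \<le> exp (- (\<mu> / 2) * (norm t)\<^sup>2)" by (rule near[OF True])
      also have "\<dots> \<le> exp (- c * (norm t)\<^sup>2)"
        using mult_right_mono[OF c(2), of "(norm t)\<^sup>2"] by simp
      finally show ?thesis .
    next
      case False
      have "c * (norm t)\<^sup>2 \<le> c * R\<^sup>2" using R(2)[OF t] c by (intro mult_left_mono power_mono) auto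
      then have "ln s \<le> - c * (norm t)\<^sup>2" using c(3) by linarith
      then have "s \<le> exp (- c * (norm t)\<^sup>2)" using s by (metis exp_ln exp_le_cancel_iff)
      with s(3)[of t] t False show ?thesis by (force simp: K_def)
    qed
  next
    fix t
    have "gauss t \<le> exp (- \<mu> * (norm t)\<^sup>2)" by (rule \<mu>(2))
    also have "\<dots> \<le> exp (- c * (norm t)\<^sup>2)"
      using mult_right_mono[of c \<mu> "(norm t)\<^sup>2"] c(2) \<mu>(1) by simp
    finally show "gauss t \<le> exp (- c * (norm t)\<^sup>2)" .
  qed
qed

lemma charfun_off_periods:
  assumes q: "q > 0" "\<And>y i. y \<in> periods \<Longrightarrow> real q * y $ i \<in> \<int>"
  obtains \<rho> where "0 < \<rho>" "\<rho> < 1"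
    "\<And>t k. t \<in> cube q \<Longrightarrow> k \<in> grid q \<Longrightarrow> k \<notin> periods \<Longrightarrow> norm (charfun (t + k)) \<le> \<rho>"
proof -
  define K where "K = (\<Union>k\<in>grid q - periods. (\<lambda>t. t + k) ` cube q)"
  have "compact K"
    unfolding K_def cube_def
    by (intro compact_UN finite_Diff finite_grid ballI compact_continuous_image compact_cbox continuous_intros)
  moreover have "continuous_on K (\<lambda>t. norm (charfun t))"
    by (intro continuous_intros continuous_on_charfun)
  moreover have "norm (charfun x) < 1" if xK: "x \<in> K" for x
  proof -
    obtain t k where tk: "x = t + k" "t \<in> cube q" "k \<in> grid q" "k \<notin> periods"
      using xK by (auto simp: K_def)
    have "t + k \<notin> periods"
    proof
      assume "t + k \<in> periods"
      moreover from cube_period_zero[OF q tk(2,3) this] have "t = 0" .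
      ultimately show False using tk by simp
    qed
    then show ?thesis unfolding tk(1) by (rule norm_charfun_less_1)
  qed
  ultimately obtain s where "0 < s" "s < 1" "\<And>t. t \<in> K \<Longrightarrow> norm (charfun t) \<le> s"
    using compact_bound_below_1[of K "\<lambda>t. norm (charfun t)"] by blast
  then show ?thesis using that[of s] by (auto simp: K_def)
qed

text \<open>Inside the cube this is \<open>power_vs_gaussian\<close>, fed with \<open>charfun_taylor\<close> and \<open>charfun_decay\<close>.
Outside it the Gaussian is exponentially small in \<open>N\<close>, hence bounded by the same
expression; with this second estimate the Gaussian can be integrated over the whole space.\<close>

lemma integrand_near_periods:
  assumes q: "q > 0" "\<And>y i. y \<in> periods \<Longrightarrow> real q * y $ i \<in> \<int>"
  obtains C c where "C \<ge> 0" "c > 0"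
    "\<And>N t. N > 0 \<Longrightarrow> t \<in> cube q \<Longrightarrow>
       \<bar>Re (circle_exp (- (g \<bullet> t)) * charfun t ^ N) - gauss t ^ N\<bar> \<le> C / real N * exp (- c * (real N * (norm t)\<^sup>2))"
    "\<And>N t. N > 0 \<Longrightarrow> t \<notin> cube q \<Longrightarrow> gauss t ^ N \<le> C / real N * exp (- c * (real N * (norm t)\<^sup>2))"
proof -
  obtain c where c: "c > 0" "\<And>t. t \<in> cube q \<Longrightarrow> norm (charfun t) \<le> exp (- c * (norm t)\<^sup>2)"
    "\<And>t. gauss t \<le> exp (- c * (norm t)\<^sup>2)" by (rule charfun_decay[OF q]) blast+
  obtain D where D: "D \<ge> 0" "\<And>t. \<bar>Re (charfun t) - gauss t\<bar> \<le> D * norm t ^ 4"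
    "\<And>t. \<bar>Im (charfun t)\<bar> \<le> D * norm t ^ 3" by (rule charfun_taylor) blast
  define D' where "D' = D + 2 * pi\<^sup>2 * (norm g)\<^sup>2 + 2 * pi * norm g"
  have D': "D' \<ge> D" "D' \<ge> 2 * pi\<^sup>2 * (norm g)\<^sup>2" "D' \<ge> 2 * pi * norm g" "D' \<ge> 0"
    using D(1) by (auto simp: D'_def)
  obtain R where R: "R > 0" "\<And>t. t \<in> (cube q :: (real, 'n) vec set) \<Longrightarrow> norm t \<le> R"
    using bounded_cbox bounded_pos unfolding cube_def by metis
  obtain C1 where C1: "C1 \<ge> 0"
    "\<And>(a :: complex) \<gamma> b r N. \<lbrakk>N > 0; 0 \<le> r; r \<le> R; \<bar>Re a - b\<bar> \<le> D' * r ^ 4; \<bar>Im a\<bar> \<le> D' * r ^ 3;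
       \<bar>Re \<gamma> - 1\<bar> \<le> D' * r\<^sup>2; \<bar>Im \<gamma>\<bar> \<le> D' * r; norm \<gamma> \<le> 1;
       norm a \<le> exp (- c * r\<^sup>2); 0 \<le> b; b \<le> exp (- c * r\<^sup>2)\<rbrakk>
     \<Longrightarrow> \<bar>Re (\<gamma> * a ^ N) - b ^ N\<bar> \<le> C1 / real N * exp (- (c / 2) * (real N * r\<^sup>2))"
    by (rule power_vs_gaussian[of R D' c]) (use R D' c in auto)
  \<comment> \<open>outside the cube \<open>|t| \<ge> 1/(2q)\<close>, so \<open>(c/2) N |t|\<^sup>2 \<ge> N / C2\<close>\<close>
  define C2 where "C2 = 8 * (real q)\<^sup>2 / c"
  have C2: "C2 \<ge> 0" using c by (simp add: C2_def)
  show ?thesis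
  proof (rule that[of "C1 + C2" "c / 2"])
    fix N :: nat and t :: "(real, 'n) vec" assume N: "N > 0" and t: "t \<in> cube q"
    have gt: "\<bar>- (g \<bullet> t)\<bar> \<le> norm g * norm t" using Cauchy_Schwarz_ineq2[of g t] by simp
    have "\<bar>Re (circle_exp (- (g \<bullet> t)) * charfun t ^ N) - gauss t ^ N\<bar>
        \<le> C1 / real N * exp (- (c / 2) * (real N * (norm t)\<^sup>2))"
    proof (rule C1(2)[OF N norm_ge_zero R(2)[OF t]])
      show "\<bar>Re (charfun t) - gauss t\<bar> \<le> D' * norm t ^ 4" "\<bar>Im (charfun t)\<bar> \<le> D' * norm t ^ 3"
        using D' by (auto intro!: order_trans[OF D(2)] order_trans[OF D(3)] mult_right_mono)
      have "\<bar>Re (circle_exp (- (g \<bullet> t))) - 1\<bar> \<le> 2 * pi\<^sup>2 * (- (g \<bullet> t))\<^sup>2" by (rule circle_exp_near_0)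
      also have "\<dots> \<le> 2 * pi\<^sup>2 * (norm g * norm t)\<^sup>2"
        using gt abs_le_square_iff[of "- (g \<bullet> t)" "norm g * norm t"] by (intro mult_left_mono) auto
      also have "\<dots> \<le> D' * (norm t)\<^sup>2"
        using mult_right_mono[OF D'(2), of "(norm t)\<^sup>2"] by (simp add: power_mult_distrib mult_ac)
      finally show "\<bar>Re (circle_exp (- (g \<bullet> t))) - 1\<bar> \<le> D' * (norm t)\<^sup>2" .
      have "\<bar>Im (circle_exp (- (g \<bullet> t)))\<bar> \<le> 2 * pi * \<bar>- (g \<bullet> t)\<bar>" by (rule circle_exp_near_0)
      also have "\<dots> \<le> 2 * pi * (norm g * norm t)" using gt by (intro mult_left_mono) auto
      also have "\<dots> \<le> D' * norm t"
        using mult_right_mono[OF D'(3), of "norm t"] by (simp add: mult_ac)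
      finally show "\<bar>Im (circle_exp (- (g \<bullet> t)))\<bar> \<le> D' * norm t" .
      show "norm (charfun t) \<le> exp (- c * (norm t)\<^sup>2)" by (rule c(2)[OF t])
      show "gauss t \<le> exp (- c * (norm t)\<^sup>2)" by (rule c(3))
    qed (auto simp: gauss_def)
    also have "\<dots> \<le> (C1 + C2) / real N * exp (- (c / 2) * (real N * (norm t)\<^sup>2))"
      using C2 by (intro mult_right_mono divide_right_mono) auto
    finally show "\<bar>Re (circle_exp (- (g \<bullet> t)) * charfun t ^ N) - gauss t ^ N\<bar>
        \<le> (C1 + C2) / real N * exp (- (c / 2) * (real N * (norm t)\<^sup>2))" .
  next
    fix N :: nat and t :: "(real, 'n) vec" assume N: "N > 0" and t: "t \<notin> cube q"
    define x where "x = (c / 2) * (real N * (norm t)\<^sup>2)"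
    obtain i where "\<not> (- 1 / (2 * real q) \<le> t $ i \<and> t $ i \<le> 1 / (2 * real q))"
      using t by (auto simp: cube_def mem_box_cart)
    then have "\<bar>t $ i\<bar> > 1 / (2 * real q)" by (auto simp: not_le)
    then have "norm t > 1 / (2 * real q)" using component_le_norm_cart[of t i] by linarith
    then have nt: "(norm t)\<^sup>2 \<ge> (1 / (2 * real q))\<^sup>2" by (intro power_mono) auto
    have "c / 2 * (real N * (1 / (2 * real q))\<^sup>2) \<le> x"
      unfolding x_def using nt c N by (intro mult_left_mono) auto
    moreover have "c / 2 * (real N * (1 / (2 * real q))\<^sup>2) = real N / C2"
      using q c by (simp add: C2_def field_simps power2_eq_square)
    ultimately have x: "real N / C2 \<le> x" by (simp only:)
    have "C2 > 0" using c q by (simp add: C2_def)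
    then have "x > 0" using x N by (auto intro: less_le_trans[rotated])
    have "exp (- x) = 1 / exp x" by (simp add: exp_minus divide_inverse)
    also have "\<dots> \<le> 1 / x"
    proof (intro divide_left_mono)
      show "x \<le> exp x" using exp_ge_add_one_self[of x] by linarith
    qed (use \<open>x > 0\<close> in auto)
    also have "\<dots> \<le> 1 / (real N / C2)" using x \<open>C2 > 0\<close> N \<open>x > 0\<close> by (intro divide_left_mono) auto
    finally have e: "exp (- x) \<le> C2 / real N" by simp
    have "gauss t ^ N \<le> exp (- c * (norm t)\<^sup>2) ^ N" using c(3) by (intro power_mono) (auto simp: gauss_def)
    also have "\<dots> = exp (- x) * exp (- x)" by (simp add: x_def mult_ac flip: exp_of_nat_mult exp_add)
    also have "\<dots> \<le> C2 / real N * exp (- x)" using e by (intro mult_right_mono) auto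
    also have "\<dots> \<le> (C1 + C2) / real N * exp (- x)"
      using C1 by (intro mult_right_mono divide_right_mono) auto
    finally show "gauss t ^ N \<le> (C1 + C2) / real N * exp (- (c / 2) * (real N * (norm t)\<^sup>2))"
      by (simp add: x_def)
  qed (use C1 C2 c in auto)
qed

lemma has_integral_gauss_power:
  assumes "N > 0"
  shows "has_bochner_integral lborel (\<lambda>t. gauss t ^ N)
           ((2 * pi * real N) powr (- (real CARD('n) / 2)) / sqrt (det cov))"
proof -
  have "has_bochner_integral lborel (\<lambda>t. gauss t ^ N)
     ((pi / (2 * pi\<^sup>2 * real N)) powr (real CARD('n) / 2) / sqrt (det cov))"
    unfolding gauss_power
    using gaussian_integral_quadratic_form(2)[OF cov_sym cov_pos, of "2 * pi\<^sup>2 * real N"] assms by simp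
  moreover have "pi / (2 * pi\<^sup>2 * real N) = 1 / (2 * pi * real N)"
    by (simp add: power2_eq_square)
  moreover have "(1 / (2 * pi * real N)) powr (real CARD('n) / 2) = (2 * pi * real N) powr (- (real CARD('n) / 2))"
    by (simp add: powr_divide powr_minus_divide)
  ultimately show ?thesis by simp
qed

lemma det_cov_pos: "det cov > 0"
  using gaussian_integral_quadratic_form(1)[OF cov_sym cov_pos, of 1] by simp

lemma fundamental_periods:
  assumes q: "q > 0" "\<And>y i. y \<in> periods \<Longrightarrow> real q * y $ i \<in> \<int>"
  shows "{y \<in> periods. \<forall>i. 0 \<le> y $ i \<and> y $ i < 1} = grid q \<inter> periods"
proof (intro equalityI subsetI)
  fix y assume "y \<in> {y \<in> periods. \<forall>i. 0 \<le> y $ i \<and> y $ i < 1}"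
  then have y: "y \<in> periods" "\<And>i. 0 \<le> y $ i" "\<And>i. y $ i < 1" by auto
  have "y $ i \<in> (\<lambda>j. real j / real q) ` {..<q}" for i
  proof -
    obtain z :: int where z: "real q * y $ i = of_int z" using q(2)[OF y(1), of i] by (auto elim: Ints_cases)
    have "0 \<le> z" "z < int q"
    proof -
      have "0 \<le> real q * y $ i" "real q * y $ i < real q * 1"
        using y(2,3)[of i] q(1) by (auto intro!: mult_strict_left_mono simp del: mult_1_right)
      then show "0 \<le> z" "z < int q" unfolding z by linarith+
    qed
    then show ?thesis using z q(1) by (intro image_eqI[of _ _ "nat z"]) (auto simp: field_simps)
  qed
  then show "y \<in> grid q \<inter> periods" using y by (auto simp: grid_def)
next
  fix y assume y: "y \<in> grid q \<inter> periods"
  have "0 \<le> y $ i \<and> y $ i < 1" for i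
  proof -
    have "y $ i \<in> (\<lambda>j. real j / real q) ` {..<q}" using y by (auto simp: grid_def)
    then show ?thesis using q(1) by auto
  qed
  then show "y \<in> {y \<in> periods. \<forall>i. 0 \<le> y $ i \<and> y $ i < 1}" using y by auto
qed

lemma finite_fundamental_periods: "finite {y \<in> periods. \<forall>i. 0 \<le> y $ i \<and> y $ i < 1}"
proof -
  obtain q :: nat where q: "q > 0" "\<And>y i. y \<in> periods \<Longrightarrow> real q * y $ i \<in> \<int>"
    by (rule periods_denominator) blast
  have "{y \<in> periods. \<forall>i. 0 \<le> y $ i \<and> y $ i < 1} = grid q \<inter> periods"
    by (rule fundamental_periods) (use q in auto)
  then show ?thesis by (simp add: finite_grid)
qed

text \<open>The number of periods in the half-open unit cube counts the peaks of \<open>\<bar>charfun\<bar>\<close> on the torus. At every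
peak the integrand differs from the Gaussian by an error whose integral is smaller by a factor \<open>1/N\<close>.\<close>

theorem local_limit:
  assumes g: "\<And>y. y \<in> periods \<Longrightarrow> g \<bullet> y \<in> \<int>"
  obtains C where "\<And>N. N > 0 \<Longrightarrow>
    \<bar>walk_prob N g - real (card {y \<in> periods. \<forall>i. 0 \<le> y $ i \<and> y $ i < 1}) *
        ((2 * pi * real N) powr (- (real CARD('n) / 2)) / sqrt (det cov))\<bar>
      \<le> C * (real N powr (- (real CARD('n) / 2)) / real N)"
proof -
  obtain q :: nat where q: "q > 0" "\<And>y i. y \<in> periods \<Longrightarrow> real q * y $ i \<in> \<int>"
    by (rule periods_denominator) blast
  define G where "G = (grid q :: (real, 'n) vec set)"
  have fG: "finite G" by (simp add: G_def finite_grid)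
  have fund: "{y \<in> periods. \<forall>i. 0 \<le> y $ i \<and> y $ i < 1} = G \<inter> periods"
    unfolding G_def by (rule fundamental_periods) (use q in auto)
  define m where "m = real (card (G \<inter> periods))"
  have gi: "g $ i \<in> \<int>" for i
  proof -
    have "axis i 1 \<in> periods" using v_int by (simp add: periods_def inner_axis)
    from g[OF this] show ?thesis by (simp add: inner_axis)
  qed
  obtain C1 c where C1: "C1 \<ge> 0" "c > 0"
    "\<And>N t. N > 0 \<Longrightarrow> t \<in> cube q \<Longrightarrow>
       \<bar>Re (circle_exp (- (g \<bullet> t)) * charfun t ^ N) - gauss t ^ N\<bar> \<le> C1 / real N * exp (- c * (real N * (norm t)\<^sup>2))"
    "\<And>N t. N > 0 \<Longrightarrow> t \<notin> cube q \<Longrightarrow> gauss t ^ N \<le> C1 / real N * exp (- c * (real N * (norm t)\<^sup>2))"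
    by (rule integrand_near_periods[OF q, where g=g]) blast+
  obtain \<rho> where \<rho>: "0 < \<rho>" "\<rho> < 1"
    "\<And>t k. t \<in> cube q \<Longrightarrow> k \<in> grid q \<Longrightarrow> k \<notin> periods \<Longrightarrow> norm (charfun (t + k)) \<le> \<rho>"
    by (rule charfun_off_periods[OF q]) blast+
  let ?n2 = "real CARD('n) / 2"
  obtain C3 where C3: "C3 \<ge> 0" "\<And>N. N > 0 \<Longrightarrow> \<rho> ^ N \<le> C3 * (real N powr (- ?n2) / real N)"
    by (rule geometric_le_power[OF \<rho>(1,2)]) blast
  let ?F = "\<lambda>N t. indicator (cube q) t * (\<Sum>k\<in>G. Re (circle_exp (- (g \<bullet> (t + k))) * charfun (t + k) ^ N))"
  \<comment> \<open>error near the \<open>m\<close> periods, and a bound for the cubes that contain no period\<close>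
  let ?E = "\<lambda>N t. m * C1 / real N * exp (- c * real N * (norm (t :: (real, 'n) vec))\<^sup>2) + real (card G) * \<rho> ^ N * indicator (cube q) t"
  have pw: "\<bar>?F N t - m * gauss t ^ N\<bar> \<le> ?E N t" if N: "N > 0" for N t
  proof (cases "t \<in> cube q")
    case True
    let ?h = "\<lambda>k. Re (circle_exp (- (g \<bullet> (t + k))) * charfun (t + k) ^ N)"
    have "sum ?h G = sum ?h (G \<inter> periods) + sum ?h (G - periods)"
      by (rule sum.Int_Diff[OF fG])
    moreover have "sum ?h (G \<inter> periods) = m * Re (circle_exp (- (g \<bullet> t)) * charfun t ^ N)"
    proof -
      have "?h k = Re (circle_exp (- (g \<bullet> t)) * charfun t ^ N)" if "k \<in> G \<inter> periods" for k
      proof -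
        have "circle_exp (- (g \<bullet> (t + k))) = circle_exp (- (g \<bullet> t)) * circle_exp (- (g \<bullet> k))"
          by (simp add: inner_add_right flip: circle_exp_add)
        then show ?thesis using that g by (simp add: circle_exp_int charfun_add_period)
      qed
      then show ?thesis by (simp add: m_def)
    qed
    moreover have "\<bar>sum ?h (G - periods)\<bar> \<le> real (card G) * \<rho> ^ N"
    proof -
      have "\<bar>sum ?h (G - periods)\<bar> \<le> (\<Sum>k\<in>G - periods. \<bar>?h k\<bar>)" by (rule sum_abs)
      also have "\<dots> \<le> (\<Sum>k\<in>G - periods. \<rho> ^ N)"
      proof (intro sum_mono)
        fix k assume "k \<in> G - periods"
        then have "norm (charfun (t + k)) \<le> \<rho>" using \<rho>(3)[OF True] by (auto simp: G_def)
        then have "norm (circle_exp (- (g \<bullet> (t + k))) * charfun (t + k) ^ N) \<le> \<rho> ^ N"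
          by (simp add: norm_mult norm_power power_mono)
        then show "\<bar>?h k\<bar> \<le> \<rho> ^ N" using abs_Re_le_cmod order_trans by blast
      qed
      also have "\<dots> \<le> real (card G) * \<rho> ^ N"
        using fG \<rho>(1) by (auto intro!: mult_right_mono card_mono)
      finally show ?thesis .
    qed
    moreover have "\<bar>m * Re (circle_exp (- (g \<bullet> t)) * charfun t ^ N) - m * gauss t ^ N\<bar>
        \<le> m * C1 / real N * exp (- c * real N * (norm t)\<^sup>2)"
    proof -
      have "\<bar>m * Re (circle_exp (- (g \<bullet> t)) * charfun t ^ N) - m * gauss t ^ N\<bar>
          = m * \<bar>Re (circle_exp (- (g \<bullet> t)) * charfun t ^ N) - gauss t ^ N\<bar>"
        by (simp add: m_def abs_mult flip: right_diff_distrib)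
      also have "\<dots> \<le> m * (C1 / real N * exp (- c * (real N * (norm t)\<^sup>2)))"
        using C1(3)[OF N True] by (intro mult_left_mono) (auto simp: m_def)
      finally show ?thesis by (simp add: mult_ac)
    qed
    moreover have "?F N t = sum ?h G" using True by simp
    moreover have "?E N t = m * C1 / real N * exp (- c * real N * (norm t)\<^sup>2) + real (card G) * \<rho> ^ N"
      using True by simp
    ultimately show ?thesis by linarith
  next
    case False
    have "m * gauss t ^ N \<le> m * (C1 / real N * exp (- c * (real N * (norm t)\<^sup>2)))"
      using C1(4)[OF N False] by (intro mult_left_mono) (auto simp: m_def)
    moreover have "m * gauss t ^ N \<ge> 0" by (simp add: m_def gauss_def)
    ultimately show ?thesis using False by (simp add: mult_ac)
  qed
  define Q where "Q = measure lborel (cube q :: (real, 'n) vec set)"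
  define C where "C = m * C1 * (pi / c) powr ?n2 + real (card G) * C3 * Q"
  have "\<bar>walk_prob N g - m * ((2 * pi * real N) powr (- ?n2) / sqrt (det cov))\<bar>
      \<le> C * (real N powr (- ?n2) / real N)" if N: "N > 0" for N
  proof -
    have "has_bochner_integral lborel (\<lambda>t. ?F N t - m * gauss t ^ N)
        (walk_prob N g - m * ((2 * pi * real N) powr (- ?n2) / sqrt (det cov)))"
      unfolding G_def
      by (intro has_bochner_integral_diff has_bochner_integral_mult_right walk_prob_fourier q(1) gi
          has_integral_gauss_power N)
    moreover have "has_bochner_integral lborel (?E N)
       (m * C1 / real N * ((pi / (c * real N)) powr ?n2) + real (card G) * \<rho> ^ N * Q)"
    proof (intro has_bochner_integral_add has_bochner_integral_mult_right)
      have "(\<lambda>t :: (real, 'n) vec. exp (- c * real N * (norm t)\<^sup>2)) \<in> borel_measurable lborel" by measurable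
      then show "has_bochner_integral lborel (\<lambda>t :: (real, 'n) vec. exp (- c * real N * (norm t)\<^sup>2)) ((pi / (c * real N)) powr ?n2)"
        using gaussian_integral_norm[of "c * real N", where 'n='n] C1(2) N
        by (intro has_bochner_integral_nn_integral) auto
      show "has_bochner_integral lborel (indicator (cube q :: (real, 'n) vec set)) Q"
        unfolding Q_def cube_def by (intro has_bochner_integral_real_indicator emeasure_lborel_cbox_finite) simp
    qed
    ultimately have "\<bar>walk_prob N g - m * ((2 * pi * real N) powr (- ?n2) / sqrt (det cov))\<bar>
        \<le> m * C1 / real N * ((pi / (c * real N)) powr ?n2) + real (card G) * \<rho> ^ N * Q"
      using Bochner_Integration.integral_norm_bound_integral[where M=lborel and f="\<lambda>t. ?F N t - m * gauss t ^ N" and g="?E N"] pw[OF N]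
      by (simp add: has_bochner_integral_iff)
    also have "(pi / (c * real N)) powr ?n2 = (pi / c) powr ?n2 * real N powr (- ?n2)"
      using C1(2) N by (simp add: powr_divide powr_mult powr_minus field_simps)
    also have "real (card G) * \<rho> ^ N * Q \<le> real (card G) * (C3 * (real N powr (- ?n2) / real N)) * Q"
      using C3(2)[OF N] by (intro mult_right_mono mult_left_mono) (auto simp: Q_def)
    finally show ?thesis by (simp add: C_def algebra_simps)
  qed
  then show ?thesis unfolding m_def fund[symmetric] by (rule that)
qed

end

section \<open>Lattices, the tilting point and index types\<close>

text \<open>A copy of a finite index type, ordered through an enumeration. Linear changes of variables in
\<open>real^'n\<close> are formulated for a well-ordered index type, whereas a lattice basis is
indexed by an arbitrary finite type; no determinant depends on the order.\<close>

typedef 'a well_ordered = "UNIV :: 'a set" ..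

lemma bij_Rep_well_ordered: "bij Rep_well_ordered"
  using type_definition.Rep_range[OF type_definition_well_ordered] Rep_well_ordered_inject
  by (auto simp: bij_def inj_def)

instantiation well_ordered :: (finite) "{finite, wellorder}"
begin

definition less_eq_well_ordered :: "'a well_ordered \<Rightarrow> 'a well_ordered \<Rightarrow> bool"
  where "x \<le> y \<longleftrightarrow> to_nat (Rep_well_ordered x) \<le> to_nat (Rep_well_ordered y)"

definition less_well_ordered :: "'a well_ordered \<Rightarrow> 'a well_ordered \<Rightarrow> bool"
  where "x < y \<longleftrightarrow> to_nat (Rep_well_ordered x) < to_nat (Rep_well_ordered y)"

instance
proof
  have "bij_betw Rep_well_ordered (UNIV :: 'a well_ordered set) UNIV" by (rule bij_Rep_well_ordered)
  then show "finite (UNIV :: 'a well_ordered set)" using bij_betw_finite finite by blast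
  fix x y z :: "'a well_ordered"
  show "(x < y) = (x \<le> y \<and> \<not> y \<le> x)" "x \<le> x" "x \<le> y \<or> y \<le> x"
    by (auto simp: less_eq_well_ordered_def less_well_ordered_def)
  show "x \<le> z" if "x \<le> y" "y \<le> z" using that by (simp add: less_eq_well_ordered_def)
  show "x = y" if "x \<le> y" "y \<le> x"
    using that by (simp add: less_eq_well_ordered_def Rep_well_ordered_inject)
next
  fix P :: "'a well_ordered \<Rightarrow> bool" and a :: "'a well_ordered"
  assume *: "\<And>x. (\<And>y. y < x \<Longrightarrow> P y) \<Longrightarrow> P x"
  show "P a"
    by (induction a rule: measure_induct_rule[of "\<lambda>x. to_nat (Rep_well_ordered x)"])
       (rule *, simp add: less_well_ordered_def)
qed

end

lemma det_reindex:
  fixes F :: "'n::finite \<Rightarrow> 'n \<Rightarrow> 'a::comm_ring_1" and r :: "'m::finite \<Rightarrow> 'n"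
  assumes r: "bij r"
  shows "det (\<chi> i j. F (r i) (r j)) = det (\<chi> i j. F i j)"
proof -
  let ?\<phi> = "map_permutation UNIV r"
  have app: "?\<phi> p (r i) = r (p i)" for p i
    using r by (simp add: map_permutation_apply bij_is_inj)
  have "?\<phi> = (\<lambda>p x. if x \<in> UNIV then r (p (inv_into UNIV r x)) else x)"
    using r by (simp add: map_permutation_def restrict_id_def bij_is_surj fun_eq_iff)
  then have bij: "bij_betw ?\<phi> {p. p permutes (UNIV :: 'm set)} {p. p permutes (UNIV :: 'n set)}"
    using bij_betw_permutations[OF r] by simp
  have "det (\<chi> i j. F i j) = (\<Sum>p\<in>{p. p permutes (UNIV :: 'm set)}. of_int (sign (?\<phi> p)) * (\<Prod>i\<in>UNIV. F i (?\<phi> p i)))"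
    unfolding det_def by (simp add: sum.reindex_bij_betw[OF bij, symmetric])
  also have "\<dots> = (\<Sum>p\<in>{p. p permutes (UNIV :: 'm set)}. of_int (sign p) * (\<Prod>i\<in>UNIV. F (r i) (r (p i))))"
  proof (intro sum.cong refl)
    fix p assume "p \<in> {p. p permutes (UNIV :: 'm set)}"
    then have "sign (?\<phi> p) = sign p"
      using r by (intro sign_map_permutation) (auto simp: bij_is_inj)
    moreover have "(\<Prod>i\<in>UNIV. F i (?\<phi> p i)) = (\<Prod>i\<in>UNIV. F (r i) (r (p i)))"
      by (subst prod.reindex_bij_betw[OF r, symmetric]) (simp add: app)
    ultimately show "of_int (sign (?\<phi> p)) * (\<Prod>i\<in>UNIV. F i (?\<phi> p i)) = of_int (sign p) * (\<Prod>i\<in>UNIV. F (r i) (r (p i)))"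
      by simp
  qed
  finally show ?thesis by (simp add: det_def)
qed

interpretation int_mod: module "\<lambda>k::int. scaleR (real_of_int k) :: 'v::real_vector \<Rightarrow> 'v"
  by unfold_locales (auto simp: algebra_simps)

lemma diff_mem_diffs: "b \<in> S \<Longrightarrow> b' \<in> S \<Longrightarrow> b - b' \<in> diffs S"
  by (auto simp: diffs_def)

text \<open>The differences \<open>b - a\<close> for a fixed \<open>a\<close> in \<open>S\<close> already generate \<open>lattice_of_dual S\<close>.\<close>

lemma mem_lattice_of_iff:
  assumes "a \<in> S"
  shows "x \<in> lattice_of S \<longleftrightarrow> (\<forall>b\<in>S. pairing (b - a) x \<in> \<int>)"
proof
  assume "x \<in> lattice_of S"
  then show "\<forall>b\<in>S. pairing (b - a) x \<in> \<int>"
    using assms diff_mem_diffs int_mod.span_base unfolding lattice_of_def lattice_of_dual_def by blast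
next
  assume *: "\<forall>b\<in>S. pairing (b - a) x \<in> \<int>"
  have "pairing f x \<in> \<int>" if "f \<in> int_span (diffs S)" for f
    using that
  proof (induction rule: int_mod.span_induct)
    case base
    show ?case by (auto simp: int_mod.subspace_def blinfun.add_left blinfun.scaleR_left)
  next
    case (step f)
    then obtain b b' where f: "f = b - b'" "b \<in> S" "b' \<in> S" by (auto simp: diffs_def)
    have "pairing (b - a) x - pairing (b' - a) x \<in> \<int>" using * f by (intro Ints_diff) auto
    then show ?case by (simp add: f blinfun.diff_left)
  qed
  then show "x \<in> lattice_of S" by (auto simp: lattice_of_def lattice_of_dual_def)
qed

lemma int_span_range:
  fixes e :: "'n::finite \<Rightarrow> 'a::real_vector"
  shows "int_span (range e) = range (\<lambda>m :: 'n \<Rightarrow> int. \<Sum>i\<in>UNIV. of_int (m i) *\<^sub>R e i)"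
proof
  let ?R = "range (\<lambda>m :: 'n \<Rightarrow> int. \<Sum>i\<in>UNIV. of_int (m i) *\<^sub>R e i)"
  have "int_mod.subspace ?R"
    unfolding int_mod.subspace_def
  proof (intro conjI ballI allI)
    show "0 \<in> ?R" by (rule image_eqI[of _ _ "\<lambda>_. 0"]) auto
    fix x y assume "x \<in> ?R" "y \<in> ?R"
    then obtain m m' where "x = (\<Sum>i\<in>UNIV. of_int (m i) *\<^sub>R e i)" "y = (\<Sum>i\<in>UNIV. of_int (m' i) *\<^sub>R e i)"
      by auto
    then show "x + y \<in> ?R"
      by (intro image_eqI[of _ _ "\<lambda>i. m i + m' i"]) (auto simp: scaleR_add_left sum.distrib)
  next
    fix k :: int and x assume "x \<in> ?R"
    then obtain m where "x = (\<Sum>i\<in>UNIV. of_int (m i) *\<^sub>R e i)" by auto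
    then show "of_int k *\<^sub>R x \<in> ?R"
      by (intro image_eqI[of _ _ "\<lambda>i. k * m i"]) (auto simp: scaleR_sum_right)
  qed
  moreover have "e i \<in> ?R" for i
    by (rule image_eqI[of _ _ "\<lambda>j. if j = i then 1 else 0"])
       (simp_all add: if_distrib[of "\<lambda>r. r *\<^sub>R _"] if_distrib[of of_int] cong: if_cong)
  ultimately show "int_span (range e) \<subseteq> ?R"
    by (intro int_mod.span_minimal) auto
  show "?R \<subseteq> int_span (range e)"
  proof
    fix x assume "x \<in> ?R"
    then obtain m where "x = (\<Sum>i\<in>UNIV. of_int (m i) *\<^sub>R e i)" by auto
    also have "\<dots> \<in> int_span (range e)"
      by (intro int_mod.span_sum int_mod.span_scale int_mod.span_base rangeI)
    finally show "x \<in> int_span (range e)" .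
  qed
qed

text \<open>After clearing the denominator, the condition on \<open>\<tau>\<close> says that the derivative of
\<open>\<tau> \<mapsto> \<Sum> c(b) exp \<langle>b - a,\<tau>\<rangle>\<close> vanishes at \<open>\<tau>\<close>, up to the positive factor \<open>exp \<langle>a,\<tau>\<rangle>\<close>.\<close>

lemma mu_P_eq_iff:
  assumes "finite S" "S \<noteq> {}" "\<And>b. b \<in> S \<Longrightarrow> c b > 0"
  shows "mu_P S c \<tau> = a \<longleftrightarrow> (\<forall>x. (\<Sum>b\<in>S. c b * exp (pairing b \<tau>) * pairing (b - a) x) = 0)"
proof -
  let ?Z = "\<Sum>b\<in>S. c b * exp (pairing b \<tau>)"
  have Z: "?Z > 0" using assms by (intro sum_pos) auto
  have "pairing (mu_P S c \<tau>) x = (\<Sum>b\<in>S. c b * exp (pairing b \<tau>) * pairing b x) / ?Z" for x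
    by (simp add: mu_P_def weight_def blinfun.sum_left blinfun.scaleR_left sum_divide_distrib)
  then have "pairing (mu_P S c \<tau>) x = pairing a x \<longleftrightarrow>
      (\<Sum>b\<in>S. c b * exp (pairing b \<tau>) * pairing (b - a) x) = 0" for x
  proof -
    have "(\<Sum>b\<in>S. c b * exp (pairing b \<tau>) * pairing (b - a) x)
        = (\<Sum>b\<in>S. c b * exp (pairing b \<tau>) * pairing b x) - ?Z * pairing a x"
      by (simp add: blinfun.diff_left right_diff_distrib sum_subtractf sum_distrib_right)
    moreover have "pairing (mu_P S c \<tau>) x = (\<Sum>b\<in>S. c b * exp (pairing b \<tau>) * pairing b x) / ?Z" by fact
    ultimately show ?thesis using Z by (simp add: divide_eq_eq mult.commute)
  qed
  moreover have "mu_P S c \<tau> = a \<longleftrightarrow> (\<forall>x. pairing (mu_P S c \<tau>) x = pairing a x)"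
    by (auto intro: blinfun_eqI)
  ultimately show ?thesis by simp
qed

text \<open>A ball of radius \<open>r\<close> about \<open>a\<close> fits into the convex hull, and its point farthest in the direction of
\<open>\<tau>\<close> cannot lie beyond all points of \<open>S\<close>.\<close>

lemma supporting_growth:
  fixes S :: "'a::euclidean_space dual set"
  assumes a: "a \<in> interior (convex hull S)"
  obtains r where "r > 0" "\<And>\<tau>. \<exists>b\<in>S. r * norm \<tau> \<le> pairing (b - a) \<tau>"
proof -
  obtain r where r: "r > 0" "cball a r \<subseteq> convex hull S"
    using a by (auto simp: mem_interior_cball)
  have "\<exists>b\<in>S. r * norm \<tau> \<le> pairing (b - a) \<tau>" for \<tau>
  proof (rule ccontr)
    assume "\<not> (\<exists>b\<in>S. r * norm \<tau> \<le> pairing (b - a) \<tau>)"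
    then have lt: "\<And>b. b \<in> S \<Longrightarrow> pairing b \<tau> < pairing a \<tau> + r * norm \<tau>"
      by (force simp: blinfun.diff_left not_le)
    let ?H = "(\<lambda>b. pairing b \<tau>) -` {..< pairing a \<tau> + r * norm \<tau>}"
    have "convex ?H"
      by (intro convex_linear_vimage bounded_linear.linear blinfun.bounded_linear_left convex_real_interval)
    then have hull: "convex hull S \<subseteq> ?H" using lt by (intro hull_minimal) auto
    define h where "h = (r / norm \<tau>) *\<^sub>R (blinfun_inner_right \<tau> :: 'a dual)"
    have "norm (blinfun_inner_right \<tau> :: 'a dual) \<le> norm \<tau>"
      by (rule norm_blinfun_bound) (auto simp: Cauchy_Schwarz_ineq2)
    then have "norm h \<le> r"
      using r(1) by (cases "\<tau> = 0") (auto simp: h_def field_simps)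
    then have "a + h \<in> cball a r" by (simp add: dist_norm)
    then have "a + h \<in> ?H" using r(2) hull by blast
    moreover have "pairing h \<tau> = r * norm \<tau>"
      by (simp add: h_def blinfun.scaleR_left power2_norm_eq_inner[symmetric] power2_eq_square)
    ultimately show False by (simp add: blinfun.add_left)
  qed
  with r(1) show ?thesis using that by blast
qed

text \<open>The function \<open>G \<tau> = \<Sum> c(b) exp \<langle>b - a,\<tau>\<rangle>\<close> tends to infinity with \<open>|\<tau>|\<close> by \<open>supporting_growth\<close>, so it
has a minimum, which is the critical point required by \<open>mu_P_eq_iff\<close>.\<close>

lemma mu_P_surj_interior:
  fixes S :: "'a::euclidean_space dual set"
  assumes S: "finite S" and c: "\<And>b. b \<in> S \<Longrightarrow> c b > 0" and a: "a \<in> interior (convex hull S)"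
  obtains \<tau> where "mu_P S c \<tau> = a"
proof -
  have ne: "S \<noteq> {}" using a by auto
  obtain r where r: "r > 0" "\<And>\<tau>. \<exists>b\<in>S. r * norm \<tau> \<le> pairing (b - a) \<tau>"
    using supporting_growth[OF a] by blast
  define m where "m = Min (c ` S)"
  have m: "m > 0" "\<And>b. b \<in> S \<Longrightarrow> m \<le> c b" using S ne c by (auto simp: m_def)
  define G where "G = (\<lambda>\<tau>. \<Sum>b\<in>S. c b * exp (pairing (b - a) \<tau>))"
  have growth: "m * (r * norm \<tau>) \<le> G \<tau>" for \<tau>
  proof -
    obtain b where b: "b \<in> S" "r * norm \<tau> \<le> pairing (b - a) \<tau>" using r(2) by blast
    have "r * norm \<tau> \<le> exp (pairing (b - a) \<tau>)"
      using b(2) exp_ge_add_one_self[of "pairing (b - a) \<tau>"] by linarith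
    then have "m * (r * norm \<tau>) \<le> c b * exp (pairing (b - a) \<tau>)"
      using m(1) m(2)[OF b(1)] r(1) by (intro mult_mono) auto
    also have "\<dots> \<le> G \<tau>"
      unfolding G_def using b(1) S c by (intro member_le_sum) (auto intro: less_imp_le)
    finally show ?thesis .
  qed
  \<comment> \<open>beyond this radius the growth estimate already exceeds \<open>G 0\<close>\<close>
  define R where "R = (G 0 + 1) / (m * r)"
  have G0: "G 0 \<ge> 0" using growth[of 0] by simp
  have "R \<ge> 0" using G0 m(1) r(1) by (simp add: R_def)
  then have ne': "cball (0::'a) R \<noteq> {}" by simp
  have "continuous_on (cball 0 R) G" unfolding G_def by (intro continuous_intros)
  then obtain \<tau> where \<tau>: "\<tau> \<in> cball 0 R" "\<And>x. x \<in> cball 0 R \<Longrightarrow> G \<tau> \<le> G x"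
    using continuous_attains_inf[OF compact_cball ne'] by blast
  have min: "G \<tau> \<le> G x" for x
  proof (cases "x \<in> cball 0 R")
    case False
    then have "norm x \<ge> R" by simp
    then have "m * r * R \<le> m * r * norm x" using m(1) r(1) by (intro mult_left_mono) auto
    also have "\<dots> \<le> G x" using growth[of x] by (simp add: mult_ac)
    finally have "G 0 \<le> G x" using m(1) r(1) by (simp add: R_def)
    moreover have "G \<tau> \<le> G 0" using \<open>R \<ge> 0\<close> by (intro \<tau>(2)) simp
    ultimately show ?thesis by simp
  qed (rule \<tau>(2))
  have crit: "(\<Sum>b\<in>S. c b * exp (pairing (b - a) \<tau>) * pairing (b - a) x) = 0" for x
  proof (rule DERIV_local_min[where d=1])
    have "((\<lambda>s. G (\<tau> + s *\<^sub>R x)) has_real_derivative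
        (\<Sum>b\<in>S. c b * (exp (pairing (b - a) \<tau> + s * pairing (b - a) x) * pairing (b - a) x))) (at s)" for s
      unfolding G_def blinfun.add_right blinfun.scaleR_right
      by (auto intro!: derivative_eq_intros sum.cong)
    from this[of 0] show "DERIV (\<lambda>s. G (\<tau> + s *\<^sub>R x)) 0 :> (\<Sum>b\<in>S. c b * exp (pairing (b - a) \<tau>) * pairing (b - a) x)"
      by (simp add: mult_ac)
  qed (use min in auto)
  have "mu_P S c \<tau> = a"
  proof (subst mu_P_eq_iff[OF S ne c], assumption, rule allI)
    fix x
    have "(\<Sum>b\<in>S. c b * exp (pairing b \<tau>) * pairing (b - a) x)
        = exp (pairing a \<tau>) * (\<Sum>b\<in>S. c b * exp (pairing (b - a) \<tau>) * pairing (b - a) x)"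
      unfolding sum_distrib_left
      by (intro sum.cong) (auto simp: blinfun.diff_left exp_diff)
    then show "(\<Sum>b\<in>S. c b * exp (pairing b \<tau>) * pairing (b - a) x) = 0" by (simp add: crit)
  qed
  then show ?thesis by (rule that)
qed

section \<open>Lattice paths\<close>

definition coords :: "('n::finite \<Rightarrow> 'a::euclidean_space) \<Rightarrow> 'a dual \<Rightarrow> real^'n"
  where "coords e \<gamma> = (\<chi> i. pairing \<gamma> (e i))"

definition combo :: "('n::finite \<Rightarrow> 'a::euclidean_space) \<Rightarrow> real^'n \<Rightarrow> 'a"
  where "combo e t = (\<Sum>i\<in>UNIV. t $ i *\<^sub>R e i)"

lemma pairing_combo: "pairing \<gamma> (combo e t) = coords e \<gamma> \<bullet> t"
  by (simp add: combo_def coords_def inner_vec_def blinfun.sum_right blinfun.scaleR_right mult_ac)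

lemma coords_simps [simp]:
  "coords e 0 = 0" "coords e (x + y) = coords e x + coords e y" "coords e (x - y) = coords e x - coords e y"
  "coords e (r *\<^sub>R x) = r *\<^sub>R coords e x"
  by (simp_all add: coords_def vec_eq_iff blinfun.add_left blinfun.diff_left blinfun.scaleR_left)

lemma coords_sum: "coords e (sum f A) = (\<Sum>a\<in>A. coords e (f a))"
  by (induction A rule: infinite_finite_induct) auto

lemma combo_diff: "combo e (s - t) = combo e s - combo e t"
  by (simp add: combo_def scaleR_diff_left sum_subtractf)

lemma inj_combo: assumes "inj e" "independent (range e)" shows "inj (combo e)"
proof (rule injI)
  fix s t assume "combo e s = combo e t"
  then have "combo e (s - t) = 0" by (simp add: combo_diff)
  then have z: "(\<Sum>x\<in>range e. (s - t) $ (inv_into UNIV e x) *\<^sub>R x) = 0"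
    using assms(1) by (simp add: combo_def sum.reindex)
  have li: "\<forall>c. (\<Sum>x\<in>range e. c x *\<^sub>R x) = 0 \<longrightarrow> (\<forall>x\<in>range e. c x = 0)"
    using assms(2) unfolding independent_explicit by (rule conjunct2)
  have "\<forall>x\<in>range e. (s - t) $ (inv_into UNIV e x) = 0" by (rule li[THEN spec, THEN mp, OF z])
  then have "(s - t) $ i = 0" for i using assms(1) by simp
  then show "s = t" by (simp add: vec_eq_iff)
qed

lemma surj_combo: assumes "inj e" "span (range e) = UNIV" shows "surj (combo e)"
proof -
  have "x \<in> range (combo e)" for x
  proof -
    have "x \<in> range (\<lambda>u. \<Sum>y\<in>range e. u y *\<^sub>R y)" using assms(2) by (simp add: span_finite[symmetric])
    then obtain u where "x = (\<Sum>y\<in>range e. u y *\<^sub>R y)" by auto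
    then have "x = combo e (\<chi> i. u (e i))" using assms(1) by (simp add: combo_def sum.reindex)
    then show ?thesis by blast
  qed
  then show ?thesis by blast
qed

lemma mem_int_span_iff:
  "x \<in> int_span (range e) \<longleftrightarrow> (\<exists>t. (\<forall>i. t $ i \<in> \<int>) \<and> x = combo e t)"
proof
  assume "x \<in> int_span (range e)"
  then obtain m where "x = (\<Sum>i\<in>UNIV. of_int (m i) *\<^sub>R e i)" unfolding int_span_range by auto
  then have "(\<forall>i. (\<chi> i. of_int (m i)) $ i \<in> (\<int> :: real set)) \<and> x = combo e (\<chi> i. of_int (m i))"
    by (simp add: combo_def)
  then show "\<exists>t. (\<forall>i. t $ i \<in> \<int>) \<and> x = combo e t" by blast
next
  assume "\<exists>t. (\<forall>i. t $ i \<in> \<int>) \<and> x = combo e t"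
  then obtain t where t: "\<And>i. t $ i \<in> \<int>" "x = combo e t" by blast
  then have "x = (\<Sum>i\<in>UNIV. of_int \<lfloor>t $ i\<rfloor> *\<^sub>R e i)"
    unfolding combo_def t(2) by (intro sum.cong) (auto simp: of_int_floor)
  then show "x \<in> int_span (range e)"
    unfolding int_span_range by (intro image_eqI[of _ _ "\<lambda>i. \<lfloor>t $ i\<rfloor>"]) auto
qed

text \<open>In coordinates \<open>L\<close> is \<open>\<int>\<^sup>n\<close>, and each coset of \<open>\<int>\<^sup>n\<close> has exactly one representative in the half-open
unit cube, given by the fractional parts.\<close>

lemma order_Pi_group:
  fixes e :: "'n::finite \<Rightarrow> 'a::euclidean_space"
  assumes e: "inj e" "independent (range e)" "span (range e) = UNIV" and L: "L = int_span (range e)"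
    and S: "S \<subseteq> dual_lattice L" and a: "a \<in> S"
  shows "order (Pi_group L S) =
    card {t. (\<forall>b\<in>S. coords e (b - a) \<bullet> t \<in> \<int>) \<and> (\<forall>i. 0 \<le> t $ i \<and> t $ i < 1)}" (is "_ = card ?F")
proof -
  define coset where "coset = (\<lambda>x. (\<lambda>h. h + x) ` L)"
  have carr: "carrier (Pi_group L S) = coset ` lattice_of S"
    by (auto simp: Pi_group_def FactGroup_def RCOSETS_def r_coset_def coset_def)
  have mem: "combo e t \<in> lattice_of S \<longleftrightarrow> (\<forall>b\<in>S. coords e (b - a) \<bullet> t \<in> \<int>)" for t
    unfolding mem_lattice_of_iff[OF a] pairing_combo by (rule refl)
  have Ladd: "x + y \<in> L" "x - y \<in> L" if "x \<in> L" "y \<in> L" for x y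
    using that unfolding L by (auto intro: int_mod.span_add int_mod.span_diff)
  have L0: "0 \<in> L" unfolding L by (rule int_mod.span_zero)
  have coset_eq: "coset x = coset y \<longleftrightarrow> x - y \<in> L" for x y
  proof
    assume "coset x = coset y"
    moreover have "x \<in> coset x" using L0 by (force simp: coset_def)
    ultimately show "x - y \<in> L" by (auto simp: coset_def)
  next
    assume xy: "x - y \<in> L"
    show "coset x = coset y"
    proof (intro equalityI subsetI)
      fix z assume "z \<in> coset x"
      then obtain h where "h \<in> L" "z = h + x" by (auto simp: coset_def)
      then have "h + (x - y) \<in> L" "z = (h + (x - y)) + y" using Ladd xy by auto
      then show "z \<in> coset y" unfolding coset_def by blast
    next
      fix z assume "z \<in> coset y"
      then obtain h where "h \<in> L" "z = h + y" by (auto simp: coset_def)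
      then have "h - (x - y) \<in> L" "z = (h - (x - y)) + x" using Ladd xy by auto
      then show "z \<in> coset x" unfolding coset_def by blast
    qed
  qed
  have L_sub: "pairing (b - a) x \<in> \<int>" if "b \<in> S" "x \<in> L" for b x
    using S a that by (auto simp: dual_lattice_def blinfun.diff_left intro!: Ints_diff)
  have "bij_betw (\<lambda>t. coset (combo e t)) ?F (coset ` lattice_of S)"
  proof (rule bij_betw_imageI)
    show "inj_on (\<lambda>t. coset (combo e t)) ?F"
    proof (rule inj_onI)
      fix s t assume st: "s \<in> ?F" "t \<in> ?F" and "coset (combo e s) = coset (combo e t)"
      then have "combo e (s - t) \<in> L" by (simp add: coset_eq combo_diff)
      then obtain u where u: "\<And>i. u $ i \<in> \<int>" "combo e (s - t) = combo e u"
        unfolding L mem_int_span_iff by blast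
      have "s - t = u" using inj_combo[OF e(1,2)] u(2) by (simp add: inj_def)
      have "(s - t) $ i = 0" for i
      proof (rule abs_lt_1_int_0)
        show "(s - t) $ i \<in> \<int>" using u(1) \<open>s - t = u\<close> by simp
        have "0 \<le> s $ i \<and> s $ i < 1" "0 \<le> t $ i \<and> t $ i < 1" using st by auto
        then show "\<bar>(s - t) $ i\<bar> < 1" by (simp add: abs_less_iff)
      qed
      then show "s = t" by (simp add: vec_eq_iff)
    qed
    show "(\<lambda>t. coset (combo e t)) ` ?F = coset ` lattice_of S"
    proof (intro equalityI subsetI)
      fix z assume "z \<in> coset ` lattice_of S"
      then obtain x where x: "x \<in> lattice_of S" "z = coset x" by blast
      obtain t where t: "x = combo e t" using surj_combo[OF e(1,3)] by (metis surjD)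
      define s where "s = (\<chi> i. frac (t $ i))"
      have "t - s = (\<chi> i. of_int \<lfloor>t $ i\<rfloor>)" by (simp add: s_def vec_eq_iff frac_def)
      then have ts: "combo e (t - s) \<in> L" unfolding L mem_int_span_iff by (intro exI[of _ "t - s"]) auto
      have "z = coset (combo e s)" using ts unfolding x(2) t coset_eq combo_diff .
      moreover have "s \<in> ?F"
      proof (intro CollectI conjI ballI allI)
        fix b assume b: "b \<in> S"
        have "coords e (b - a) \<bullet> t - coords e (b - a) \<bullet> (t - s) \<in> \<int>"
          using x(1) L_sub[OF b ts] b unfolding t mem pairing_combo by (intro Ints_diff) auto
        then show "coords e (b - a) \<bullet> s \<in> \<int>" by (simp add: inner_diff_right)
      qed (auto simp: s_def frac_lt_1)
      ultimately show "z \<in> (\<lambda>t. coset (combo e t)) ` ?F" by blast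
    qed (auto simp: mem)
  qed
  then show ?thesis unfolding order_def carr by (simp add: bij_betw_same_card)
qed

text \<open>Tilting by \<open>\<tau>\<close> reduces the count of paths to \<open>local_limit\<close> for the walk with steps \<open>\<beta> - \<alpha>\<close>, written in
coordinates with respect to \<open>e\<close>. In these coordinates the covariance matrix is the matrix of \<open>A\<^sub>c(S,\<alpha>)\<close>
for the basis \<open>e\<close> and its dual basis, and the periods are the points of \<open>L(S)\<close>.\<close>

theorem lattice_path_asymptotics_well_ordered:
  fixes L :: "'a::euclidean_space set"
    and e :: "'n::{finite,wellorder} \<Rightarrow> 'a"
    and S :: "'a dual set"
    and c :: "'a dual \<Rightarrow> real"
    and \<alpha> :: "'a dual"
  assumes L: "full_lattice L" and eL: "lattice_basis e L" and SL: "S \<subseteq> dual_lattice L"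
    and S: "finite S" and span_S: "span (diffs S) = UNIV" and c: "\<forall>\<beta>\<in>S. c \<beta> > 0"
    and \<alpha>: "\<alpha> \<in> S" "\<alpha> \<in> interior (convex hull S)" and f: "f \<in> lattice_of_dual S"
  shows "\<exists>\<epsilon> \<in> O(\<lambda>N. 1 / real N). \<forall>\<^sub>F N in sequentially.
            weighted_paths S c N (real N *\<^sub>R \<alpha> + f) =
              (2 * pi * real N) powr (- (real DIM('a) / 2)) *
              (real (order (Pi_group L S)) *
                 exp (- pairing f (tau_P S c \<alpha>) + real N * delta S c \<alpha>) /
               sqrt (det_dual e (A_map S c \<alpha>))) *
              (1 + \<epsilon> N)"
proof -
  have e: "inj e" "independent (range e)" and Le: "L = int_span (range e)"
    using eL by (auto simp: lattice_basis_def)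
  have span_e: "span (range e) = UNIV"
  proof -
    obtain B where B: "span B = UNIV" "L = int_span B" using L by (auto simp: full_lattice_def)
    have "B \<subseteq> L" using B(2) int_mod.span_superset by blast
    also have "L \<subseteq> span (range e)"
      unfolding Le int_span_range by (intro image_subsetI span_sum span_scale span_base rangeI)
    finally show ?thesis using B(1) span_minimal[OF _ subspace_span] by blast
  qed
  have dim: "CARD('n) = DIM('a)"
    using dim_eq_card[of "range e" "UNIV :: 'a set"] span_e e card_image[OF e(1)] by simp
  have eLmem: "e i \<in> L" for i unfolding Le by (intro int_mod.span_base) auto
  define \<tau> where "\<tau> = tau_P S c \<alpha>"
  have mu: "mu_P S c \<tau> = \<alpha>"
  proof -
    obtain t where "mu_P S c t = \<alpha>" using mu_P_surj_interior[OF S _ \<alpha>(2), of c] c by blast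
    then show ?thesis unfolding \<tau>_def tau_P_def by (metis f_inv_into_f rangeI)
  qed
  define Z where "Z = (\<Sum>b\<in>S. c b * exp (pairing b \<tau>))"
  have Z: "Z > 0" unfolding Z_def using S \<alpha>(1) c by (intro sum_pos) auto
  define w where "w = weight S c \<tau>"
  have w_eq: "w b = c b * exp (pairing b \<tau>) / Z" for b by (simp add: w_def weight_def Z_def)
  have sum_w: "sum w S = 1" unfolding w_eq using Z by (simp add: Z_def flip: sum_divide_distrib)
  have mean: "(\<Sum>b\<in>S. w b *\<^sub>R (b - \<alpha>)) = 0"
    using mu sum_w by (simp add: mu_P_def w_def scaleR_diff_right sum_subtractf flip: scaleR_sum_left)
  define v where "v = (\<lambda>b. coords e (b - \<alpha>))"
  interpret lattice_walk S w v \<alpha>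
  proof
    show "finite S" "\<alpha> \<in> S" "sum w S = 1" by fact+
    show "w b > 0" if "b \<in> S" for b using c that Z by (simp add: w_eq)
    have "(\<Sum>b\<in>S. w b *\<^sub>R v b) = coords e (\<Sum>b\<in>S. w b *\<^sub>R (b - \<alpha>))"
      by (simp add: coords_sum v_def del: coords_simps(3))
    then show "(\<Sum>b\<in>S. w b *\<^sub>R v b) = 0" by (simp add: mean)
    show "v \<alpha> = 0" by (simp add: v_def)
    show "v b $ i \<in> \<int>" if "b \<in> S" for b i
      using that \<alpha>(1) SL eLmem[of i] unfolding v_def coords_def
      by (auto simp: dual_lattice_def blinfun.diff_left intro!: Ints_diff)
    show "t = 0" if t: "\<And>b. b \<in> S \<Longrightarrow> v b \<bullet> t = 0" for t
    proof -
      let ?x = "combo e t"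
      have "pairing b ?x = pairing \<alpha> ?x" if "b \<in> S" for b
        using t[OF that] by (simp add: v_def blinfun.diff_left flip: pairing_combo del: coords_simps(3))
      then have "diffs S \<subseteq> {\<gamma>. pairing \<gamma> ?x = 0}" by (auto simp: diffs_def blinfun.diff_left)
      moreover have "subspace {\<gamma>. pairing \<gamma> ?x = 0}"
        by (auto simp: subspace_def blinfun.add_left blinfun.scaleR_left)
      ultimately have "span (diffs S) \<subseteq> {\<gamma>. pairing \<gamma> ?x = 0}" by (rule span_minimal)
      then have "pairing (blinfun_inner_right ?x) ?x = 0" unfolding span_S by blast
      then have "combo e t = combo e 0" by (simp add: combo_def[of e 0])
      then show "t = 0" using inj_combo[OF e] by (simp add: inj_def)
    qed
  qed
  have detA: "det_dual e (A_map S c \<alpha>) = det cov"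
  proof -
    have "pairing (A_map S c \<alpha> (e j)) (e i) = cov $ i $ j" for i j
    proof -
      have *: "(\<Sum>b\<in>S. w b * pairing b x) = pairing \<alpha> x" for x
        using arg_cong[OF mu, of "\<lambda>m. pairing m x"]
        by (simp add: mu_P_def w_def blinfun.sum_left blinfun.scaleR_left)
      have "cov $ i $ j = (\<Sum>b\<in>S. w b * pairing b (e i) * pairing b (e j))
          - (\<Sum>b\<in>S. w b * pairing b (e i)) * pairing \<alpha> (e j)
          - pairing \<alpha> (e i) * (\<Sum>b\<in>S. w b * pairing b (e j))
          + pairing \<alpha> (e i) * pairing \<alpha> (e j) * sum w S"
      proof -
        have "v b $ i = pairing b (e i) - pairing \<alpha> (e i)" for b i
          by (simp add: v_def coords_def blinfun.diff_left)
        then have "cov $ i $ j = (\<Sum>b\<in>S. w b * (pairing b (e i) - pairing \<alpha> (e i)) * (pairing b (e j) - pairing \<alpha> (e j)))"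
          by (simp add: cov_def)
        then show ?thesis
          unfolding sum_distrib_left sum_distrib_right sum_subtractf[symmetric] sum.distrib[symmetric]
          by (simp add: algebra_simps)
      qed
      also have "\<dots> = (\<Sum>b\<in>S. w b * pairing b (e i) * pairing b (e j)) - pairing \<alpha> (e i) * pairing \<alpha> (e j)"
        unfolding * sum_w by simp
      also have "\<dots> = pairing (A_map S c \<alpha> (e j)) (e i)"
        by (simp add: A_map_def tensor_def blinfun.diff_left blinfun.sum_left blinfun.scaleR_left
              mult_ac flip: w_def \<tau>_def)
      finally show ?thesis by simp
    qed
    then have "(\<chi> i j. pairing (A_map S c \<alpha> (e j)) (e i)) = cov" by (simp add: vec_eq_iff)
    then show ?thesis by (simp add: det_dual_def)
  qed
  have exp_delta: "exp (delta S c \<alpha>) = Z * exp (- pairing \<alpha> \<tau>)"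
  proof -
    have "(\<Sum>b\<in>S. c b * exp (pairing (b - \<alpha>) \<tau>)) = Z * exp (- pairing \<alpha> \<tau>)"
      unfolding Z_def sum_distrib_right
      by (intro sum.cong) (auto simp: blinfun.diff_left simp flip: exp_add)
    then show ?thesis using Z by (simp add: delta_def flip: \<tau>_def)
  qed
  have paths: "weighted_paths S c N (real N *\<^sub>R \<alpha> + f)
      = exp (- pairing f \<tau> + real N * delta S c \<alpha>) * walk_prob N (coords e f)" for N
  proof -
    have prod_c: "prod_list (map c bs) = prod_list (map w bs) * Z ^ length bs * exp (- pairing (sum_list bs) \<tau>)" for bs
    proof (induction bs)
      case (Cons b bs)
      have "c b = w b * Z * exp (- pairing b \<tau>)" using Z by (simp add: w_eq exp_minus)
      then show ?case by (simp add: Cons blinfun.add_left exp_diff exp_minus field_simps)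
    qed simp
    have sum_v: "sum_list (map v bs) = coords e (sum_list bs - real (length bs) *\<^sub>R \<alpha>)" for bs
      by (induction bs) (auto simp: v_def algebra_simps)
    have inj: "coords e x = coords e y \<longleftrightarrow> x = y" for x y
    proof
      assume xy: "coords e x = coords e y"
      show "x = y"
      proof (rule blinfun_eqI)
        fix z
        obtain t where "z = combo e t" using surj_combo[OF e(1) span_e] by (metis surjD)
        then show "pairing x z = pairing y z" by (simp add: pairing_combo xy)
      qed
    qed simp
    have sets: "{bs. length bs = N \<and> set bs \<subseteq> S \<and> sum_list bs = real N *\<^sub>R \<alpha> + f}
        = {bs. set bs \<subseteq> S \<and> length bs = N \<and> sum_list (map v bs) = coords e f}"
      unfolding sum_v inj by (auto simp: algebra_simps)
    have "prod_list (map c bs) = exp (- pairing f \<tau> + real N * delta S c \<alpha>) * prod_list (map w bs)"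
      if "length bs = N" "sum_list bs = real N *\<^sub>R \<alpha> + f" for bs
    proof -
      have "exp (- pairing f \<tau> + real N * delta S c \<alpha>) = exp (- pairing f \<tau>) * (Z * exp (- pairing \<alpha> \<tau>)) ^ N"
        unfolding exp_add exp_of_nat_mult exp_delta ..
      also have "\<dots> = Z ^ N * exp (- pairing (real N *\<^sub>R \<alpha> + f) \<tau>)"
        by (simp add: power_mult_distrib blinfun.add_left blinfun.scaleR_left mult_ac flip: exp_of_nat_mult exp_add)
      finally show ?thesis unfolding prod_c that by (simp add: mult_ac)
    qed
    then show ?thesis
      unfolding weighted_paths_def walk_prob_def sum_distrib_left sets[symmetric] by (intro sum.cong) auto
  qed
  have F: "{y \<in> periods. \<forall>i. 0 \<le> y $ i \<and> y $ i < 1}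
      = {t. (\<forall>b\<in>S. coords e (b - \<alpha>) \<bullet> t \<in> \<int>) \<and> (\<forall>i. 0 \<le> t $ i \<and> t $ i < 1)}"
    unfolding periods_def by (simp add: v_def)
  define k where "k = order (Pi_group L S)"
  have k: "k = card {y \<in> periods. \<forall>i. 0 \<le> y $ i \<and> y $ i < 1}"
    unfolding k_def F by (rule order_Pi_group[OF e span_e Le SL \<alpha>(1)])
  have "0 \<in> {y \<in> periods. \<forall>i. 0 \<le> y $ i \<and> y $ i < 1}" by (simp add: periods_def)
  then have k0: "k > 0" unfolding k using finite_fundamental_periods card_gt_0_iff by blast
  have fint: "coords e f \<bullet> y \<in> \<int>" if "y \<in> periods" for y
  proof -
    have "combo e y \<in> lattice_of S"
      using that unfolding mem_lattice_of_iff[OF \<alpha>(1)] pairing_combo periods_def by (simp add: v_def)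
    then show ?thesis using f by (simp add: lattice_of_def flip: pairing_combo)
  qed
  obtain C where C: "\<And>N. N > 0 \<Longrightarrow>
    \<bar>walk_prob N (coords e f) - real k * ((2 * pi * real N) powr (- (real CARD('n) / 2)) / sqrt (det cov))\<bar>
      \<le> C * (real N powr (- (real CARD('n) / 2)) / real N)"
    unfolding k by (rule local_limit[of "coords e f"]) (use fint in auto)
  have "\<exists>\<epsilon> \<in> O(\<lambda>N. 1 / real N). \<forall>\<^sub>F N in sequentially. walk_prob N (coords e f) =
      real k / sqrt (det cov) * (2 * pi * real N) powr (- (real CARD('n) / 2)) * (1 + \<epsilon> N)"
    by (rule asymptotic_equivalence_from_error[where C=C]) (use C k0 det_cov_pos in auto)
  then obtain \<epsilon> where \<epsilon>: "\<epsilon> \<in> O(\<lambda>N. 1 / real N)" "\<forall>\<^sub>F N in sequentially. walk_prob N (coords e f) =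
      real k / sqrt (det cov) * (2 * pi * real N) powr (- (real CARD('n) / 2)) * (1 + \<epsilon> N)"
    by blast
  show ?thesis
  proof (rule bexI[OF _ \<epsilon>(1)])
    show "\<forall>\<^sub>F N in sequentially. weighted_paths S c N (real N *\<^sub>R \<alpha> + f) =
              (2 * pi * real N) powr (- (real DIM('a) / 2)) *
              (real (order (Pi_group L S)) *
                 exp (- pairing f (tau_P S c \<alpha>) + real N * delta S c \<alpha>) /
               sqrt (det_dual e (A_map S c \<alpha>))) *
              (1 + \<epsilon> N)"
      using \<epsilon>(2)
    proof eventually_elim
      case (elim N)
      show ?case unfolding paths elim detA dim k_def \<tau>_def by simp
    qed
  qed
qed

text \<open>The summand at \<open>\<alpha>\<close> is \<open>c \<alpha>\<close> whatever \<open>\<tau>\<close> is, and a second point of \<open>S\<close> adds a positive amount.\<close>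

lemma delta_pos:
  fixes S :: "'a::euclidean_space dual set"
  assumes S: "finite S" "card S \<ge> 2" and c: "\<And>b. b \<in> S \<Longrightarrow> c b > 0" and \<alpha>: "\<alpha> \<in> S" "c \<alpha> \<ge> 1"
  shows "delta S c \<alpha> > 0"
proof -
  let ?g = "\<lambda>b. c b * exp (pairing (b - \<alpha>) (tau_P S c \<alpha>))"
  have "S - {\<alpha>} \<noteq> {}"
  proof
    assume "S - {\<alpha>} = {}"
    then have "S \<subseteq> {\<alpha>}" by blast
    then have "card S \<le> 1" using card_mono[of "{\<alpha>}" S] by simp
    with S(2) show False by simp
  qed
  then have "sum ?g (S - {\<alpha>}) > 0" using S(1) c by (intro sum_pos) auto
  moreover have "sum ?g S = c \<alpha> + sum ?g (S - {\<alpha>})" using S(1) \<alpha>(1) by (simp add: sum.remove)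
  ultimately show ?thesis using \<alpha>(2) by (simp add: delta_def)
qed

theorem theorem10:
  fixes L :: "'a::euclidean_space set"
    and e :: "'n::finite \<Rightarrow> 'a"
    and S :: "'a dual set"
    and c :: "'a dual \<Rightarrow> real"
    and \<alpha> :: "'a dual"
  assumes "full_lattice L"
    and "lattice_basis e L"
    and "S \<subseteq> dual_lattice L"
    and "finite S"
    and "card S \<ge> 2"
    and "span (diffs S) = UNIV"
    and "\<forall>\<beta>\<in>S. c \<beta> > 0"
    and "\<alpha> \<in> S"
    and "\<alpha> \<in> interior (convex hull S)"
  shows "(\<forall>f \<in> lattice_of_dual S. \<exists>\<epsilon> \<in> O(\<lambda>N. 1 / real N). \<forall>\<^sub>F N in sequentially.
            weighted_paths S c N (real N *\<^sub>R \<alpha> + f) =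
              (2 * pi * real N) powr (- (real DIM('a) / 2)) *
              (real (order (Pi_group L S)) *
                 exp (- pairing f (tau_P S c \<alpha>) + real N * delta S c \<alpha>) /
               sqrt (det_dual e (A_map S c \<alpha>))) *
              (1 + \<epsilon> N))
         \<and> (c \<alpha> \<ge> 1 \<longrightarrow> delta S c \<alpha> > 0)"
proof (intro conjI ballI impI)
  fix f assume f: "f \<in> lattice_of_dual S"
  let ?e = "e \<circ> (Rep_well_ordered :: 'n well_ordered \<Rightarrow> 'n)"
  have range: "range ?e = range e"
    using bij_Rep_well_ordered[where 'a='n] by (metis bij_is_surj image_comp)
  have "inj ?e" using assms(2) bij_Rep_well_ordered[where 'a='n]
    by (auto simp: lattice_basis_def intro: inj_compose bij_is_inj)
  then have e': "lattice_basis ?e L" using assms(2) unfolding lattice_basis_def range by blast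
  have det: "det_dual ?e A = det_dual e A" for A
    unfolding det_dual_def o_def
    using det_reindex[OF bij_Rep_well_ordered[where 'a='n], of "\<lambda>i j. pairing (A (e j)) (e i)"] by simp
  show "\<exists>\<epsilon> \<in> O(\<lambda>N. 1 / real N). \<forall>\<^sub>F N in sequentially.
            weighted_paths S c N (real N *\<^sub>R \<alpha> + f) =
              (2 * pi * real N) powr (- (real DIM('a) / 2)) *
              (real (order (Pi_group L S)) *
                 exp (- pairing f (tau_P S c \<alpha>) + real N * delta S c \<alpha>) /
               sqrt (det_dual e (A_map S c \<alpha>))) *
              (1 + \<epsilon> N)"
    using lattice_path_asymptotics_well_ordered[OF assms(1) e' assms(3,4,6-9) f] unfolding det .
next
  assume "c \<alpha> \<ge> 1"
  then show "delta S c \<alpha> > 0" using assms by (intro delta_pos) auto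
qed

end
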